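(* Let $0<q<1$ and let $\alpha_1,\alpha_2,\beta_1,\beta_2,\gamma_3,\eta_1,\eta_2,\mu_2,\lambda_1,\lambda_2,\lambda_3\in\mathbb{C}$ with $\Re(\alpha_1+\eta_1)>\Re(\lambda_1)>0$, $\Re(\beta_2+\mu_2)>\Re(\lambda_2)>0$ and $\Re(\gamma_3)>\Re(\beta_1)>0$. Let $x,y,z\in\mathbb{C}$, $x,y\ne0$, with $|x|,|y|,|z|<1$, $|xq^{\lambda_3}|<1$, $|yq^{\eta_2}|<1$, $|zq^{\alpha_2-\eta_2}|<1$, and assume no denominator occurring below vanishes. Then \begin{align*} &\widetilde{\Phi}_K[\alpha_1,\alpha_2,\alpha_2,\beta_1,\beta_2,\beta_1;\alpha_1+\eta_1,\beta_2+\mu_2,\gamma_3;q,x,y,z] =\int_{[0,1]^3}\frac{(uxq^{\lambda_3},vyq^{\eta_2};q)_\infty}{(ux,vy;q)_\infty}\\ &\quad\cdot\phi^{(3)}\left[\begin{matrix}-::-;q^{\eta_2};q^{\lambda_3}:q^{\lambda_1-\eta_1},u^{-1};q^{\lambda_2-\mu_2},v^{-1};-\\ -::-;-;-:q^{\lambda_1},q/(ux);q^{\lambda_2},q/(vy);uxq^{\lambda_3},vyq^{\eta_2},q^{\lambda_3}\end{matrix};q,q,q,wzq^{\alpha_2-\eta_2}\mathbb{E}_{q,x}\mathbb{E}_{q,y}\right]\\ &\quad\cdot\widetilde{\Phi}_K\big[\alpha_1,\alpha_2-\eta_2,\alpha_2-\eta_2,\beta_1-\lambda_3,\beta_2,\beta_1-\lambda_3;\alpha_1-\lambda_1+\eta_1,\beta_2-\lambda_2+\mu_2,\beta_1-\lambda_3;q,uxq^{\lambda_3},vyq^{\eta_2},wz\big]\\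 &\quad\cdot\mathrm{d}\mu_{\alpha_1-\lambda_1+\eta_1,\lambda_1}(u;q)\,\mathrm{d}\mu_{\beta_2-\lambda_2+\mu_2,\lambda_2}(v;q)\,\mathrm{d}\mu_{\beta_1,\gamma_3-\beta_1}(w;q), \end{align*} where $\phi^{(3)}[\cdots\mathbb{E}_{q,x}\mathbb{E}_{q,y}]$ is an operator acting on the function $\widetilde\Phi_K$ to its right, in the sense given in the context.
   Context: $(a;q)_n=\prod_{j=0}^{n-1}(1-aq^j)$, $(a;q)_\infty=\prod_{j\ge0}(1-aq^j)$, $(a_1,\dots,a_m;q)_n=(a_1;q)_n\cdots(a_m;q)_n$. The $k$-dimensional $q$-integral is $\int_{[0,1]^k}f(\mathbf{x})\,\mathrm{d}_q\mathbf{x}=(1-q)^k\sum_{n_1,\dots,n_k\ge0}f(q^{n_1},\dots,q^{n_k})q^{n_1+\cdots+n_k}$. $\Gamma_q(x)=\frac{(q;q)_\infty}{(q^x;q)_\infty}(1-q)^{1-x}$. For $\min\{\Re(\alpha),\Re(\beta)\}>0$ the $q$-Dirichlet measure is $\mathrm{d}\mu_{\alpha,\beta}(t;q)=\frac{\Gamma_q(\alpha+\beta)}{\Gamma_q(\alpha)\Gamma_q(\beta)}t^{\alpha-1}\frac{(tq;q)_\infty}{(tq^\beta;q)_\infty}\mathrm{d}_qt$. The $q$-analogue of Saran's function $F_K$ is \[ \widetilde{\Phi}_K[\alpha_1,\alpha_2,\alpha_2,\beta_1,\beta_2,\beta_1;\gamma_1,\gamma_2,\gamma_3;q,x,y,z]=\sum_{m,n,p=0}^{\infty}\frac{(q^{\alpha_1};q)_m(q^{\alpha_2};q)_{n+p}(q^{\beta_1};q)_{m+p}(q^{\beta_2};q)_n}{(q^{\gamma_1},q;q)_m(q^{\gamma_2},q;q)_n(q^{\gamma_3},q;q)_p}x^my^nz^p\quad(|x|,|y|,|z|<1).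 \] The triple basic hypergeometric series, in the case used here, is \[ \phi^{(3)}\left[\begin{matrix}-::-;b';b'':c_1,c_2;c_1',c_2';-\\ -::-;-;-:h_1,h_2;h_1',h_2';h_1'',h_2'',h_3''\end{matrix};q,X,Y,Z\right]=\sum_{m,n,p=0}^{\infty}(b';q)_{n+p}(b'';q)_{p+m}\frac{(c_1,c_2;q)_m}{(h_1,h_2;q)_m}\frac{(c_1',c_2';q)_n}{(h_1',h_2';q)_n}\frac{1}{(h_1'',h_2'',h_3'';q)_p}\frac{X^mY^nZ^p}{(q;q)_m(q;q)_n(q;q)_p}. \] (At the points $u=q^i$, $v=q^j$ of the $q$-integral the sums over $m,n$ terminate because of the parameters $u^{-1},v^{-1}$.) The $q$-shift operators are $\mathbb{E}_{q,x}f(x,y)=f(qx,y)$, $\mathbb{E}_{q,y}f(x,y)=f(x,qy)$. A power series $\sum_p a_p(T\,\mathbb{E}_{q,x}\mathbb{E}_{q,y})^p$ acts by $\sum_p a_pT^p f(q^px,q^py)$, where the coefficients $a_p$ (even if they depend on $x,y$) are not acted upon. Thus in the claim the product of the $\phi^{(3)}$-operator and $\widetilde\Phi_K[\ldots;q,uxq^{\lambda_3},vyq^{\eta_2},wz]$ means \[ \sum_{p=0}^{\infty}A_p\,(wzq^{\alpha_2-\eta_2})^p\;\widetilde\Phi_K[\ldots;q,uxq^{\lambda_3+p},vyq^{\eta_2+p},wz], \] where \[ A_p=\frac{1}{(uxq^{\lambda_3},vyq^{\eta_2},q^{\lambda_3};q)_p\,(q;q)_p}\sum_{m,n=0}^{\infty}(q^{\eta_2};q)_{n+p}(q^{\lambda_3};q)_{p+m}\frac{(q^{\lambda_1-\eta_1},u^{-1};q)_m}{(q^{\lambda_1},q/(ux);q)_m}\frac{(q^{\lambda_2-\mu_2},v^{-1};q)_n}{(q^{\lambda_2},q/(vy);q)_n}\frac{q^{m+n}}{(q;q)_m(q;q)_n},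 \] that is, $A_p$ is the coefficient of $Z^p$ in \[ \phi^{(3)}\left[\begin{matrix}-::-;q^{\eta_2};q^{\lambda_3}:q^{\lambda_1-\eta_1},u^{-1};q^{\lambda_2-\mu_2},v^{-1};-\\ -::-;-;-:q^{\lambda_1},q/(ux);q^{\lambda_2},q/(vy);uxq^{\lambda_3},vyq^{\eta_2},q^{\lambda_3}\end{matrix};q,q,q,Z\right], \] with the original $x,y$ in its parameters. *)

theory Defs
  imports "HOL-Analysis.Analysis"
begin

definition qpoch :: "complex \<Rightarrow> real \<Rightarrow> nat \<Rightarrow> complex" where
  "qpoch a q n = (\<Prod>j<n. 1 - a * of_real q ^ j)"

definition qpoch_inf :: "complex \<Rightarrow> real \<Rightarrow> complex" where
  "qpoch_inf a q = prodinf (\<lambda>j. 1 - a * of_real q ^ j)"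

abbreviation qpow :: "real \<Rightarrow> complex \<Rightarrow> complex" where
  "qpow q s \<equiv> of_real q powr s"

definition qGamma :: "real \<Rightarrow> complex \<Rightarrow> complex" where
  "qGamma q s = qpoch_inf (of_real q) q / qpoch_inf (qpow q s) q * of_real (1 - q) powr (1 - s)"

definition qintegral3 :: "real \<Rightarrow> (real \<Rightarrow> real \<Rightarrow> real \<Rightarrow> complex) \<Rightarrow> complex" where
  "qintegral3 q f = of_real ((1 - q) ^ 3) *
     (\<Sum>\<^sub>\<infinity>(i, j, k)\<in>UNIV. f (q ^ i) (q ^ j) (q ^ k) * of_real (q ^ (i + j + k)))"

text \<open>The density of the q-Dirichlet measure with respect to the q-integral.\<close>

definition qdirichlet :: "real \<Rightarrow> complex \<Rightarrow> complex \<Rightarrow> real \<Rightarrow> complex" where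
  "qdirichlet q \<alpha> \<beta> t =
     qGamma q (\<alpha> + \<beta>) / (qGamma q \<alpha> * qGamma q \<beta>) * of_real t powr (\<alpha> - 1) *
     (qpoch_inf (of_real (t * q)) q / qpoch_inf (of_real t * qpow q \<beta>) q)"

text \<open>
  The q-analogue of Saran's function; the repeated arguments of
  \<open>[\<alpha>\<^sub>1, \<alpha>\<^sub>2, \<alpha>\<^sub>2, \<beta>\<^sub>1, \<beta>\<^sub>2, \<beta>\<^sub>1; \<gamma>\<^sub>1, \<gamma>\<^sub>2, \<gamma>\<^sub>3; q, x, y, z]\<close> are passed only once.
\<close>

definition PhiK ::
  "complex \<Rightarrow> complex \<Rightarrow> complex \<Rightarrow> complex \<Rightarrow> complex \<Rightarrow> complex \<Rightarrow> complex \<Rightarrow>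
   real \<Rightarrow> complex \<Rightarrow> complex \<Rightarrow> complex \<Rightarrow> complex" where
  "PhiK \<alpha>\<^sub>1 \<alpha>\<^sub>2 \<beta>\<^sub>1 \<beta>\<^sub>2 \<gamma>\<^sub>1 \<gamma>\<^sub>2 \<gamma>\<^sub>3 q x y z =
     (\<Sum>\<^sub>\<infinity>(m, n, p)\<in>UNIV.
        qpoch (qpow q \<alpha>\<^sub>1) q m * qpoch (qpow q \<alpha>\<^sub>2) q (n + p) *
        qpoch (qpow q \<beta>\<^sub>1) q (m + p) * qpoch (qpow q \<beta>\<^sub>2) q n /
        ((qpoch (qpow q \<gamma>\<^sub>1) q m * qpoch (of_real q) q m) *
         (qpoch (qpow q \<gamma>\<^sub>2) q n * qpoch (of_real q) q n) *
         (qpoch (qpow q \<gamma>\<^sub>3) q p * qpoch (of_real q) q p)) *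
        x ^ m * y ^ n * z ^ p)"

text \<open>
  The coefficient of \<open>Z ^ p\<close> in the triple basic hypergeometric series
  \<open>\<phi>\<^sup>(\<^sup>3\<^sup>)[-::-; b'; b'': c\<^sub>1, c\<^sub>2; c\<^sub>1', c\<^sub>2'; - / -::-;-;-: h\<^sub>1, h\<^sub>2; h\<^sub>1', h\<^sub>2'; h\<^sub>1'', h\<^sub>2'', h\<^sub>3''; q, X, Y, Z]\<close>.
  If \<open>c\<^sub>2 = q ^ (-i)\<close>, the sum over \<open>m\<close> terminates at \<open>m = i\<close>; should the denominator vanish
  for some \<open>m > i\<close>, the convention \<open>0 / 0 = 0\<close> still gives the terminating sum.
\<close>

definition phi3_coeff ::
  "complex \<Rightarrow> complex \<Rightarrow> complex \<Rightarrow> complex \<Rightarrow> complex \<Rightarrow> complex \<Rightarrow>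
   complex \<Rightarrow> complex \<Rightarrow> complex \<Rightarrow> complex \<Rightarrow> complex \<Rightarrow> complex \<Rightarrow> complex \<Rightarrow>
   real \<Rightarrow> complex \<Rightarrow> complex \<Rightarrow> nat \<Rightarrow> complex" where
  "phi3_coeff b' b'' c\<^sub>1 c\<^sub>2 c\<^sub>1' c\<^sub>2' h\<^sub>1 h\<^sub>2 h\<^sub>1' h\<^sub>2' h\<^sub>1'' h\<^sub>2'' h\<^sub>3'' q X Y p =
     1 / (qpoch h\<^sub>1'' q p * qpoch h\<^sub>2'' q p * qpoch h\<^sub>3'' q p * qpoch (of_real q) q p) *
     (\<Sum>\<^sub>\<infinity>(m, n)\<in>UNIV.
        qpoch b' q (n + p) * qpoch b'' q (p + m) *
        (qpoch c\<^sub>1 q m * qpoch c\<^sub>2 q m / (qpoch h\<^sub>1 q m * qpoch h\<^sub>2 q m)) *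
        (qpoch c\<^sub>1' q n * qpoch c\<^sub>2' q n / (qpoch h\<^sub>1' q n * qpoch h\<^sub>2' q n)) *
        (X ^ m * Y ^ n / (qpoch (of_real q) q m * qpoch (of_real q) q n)))"

definition qshift_x :: "real \<Rightarrow> (complex \<Rightarrow> complex \<Rightarrow> complex) \<Rightarrow> complex \<Rightarrow> complex \<Rightarrow> complex" where
  "qshift_x q f = (\<lambda>x y. f (of_real q * x) y)"

definition qshift_y :: "real \<Rightarrow> (complex \<Rightarrow> complex \<Rightarrow> complex) \<Rightarrow> complex \<Rightarrow> complex \<Rightarrow> complex" where
  "qshift_y q f = (\<lambda>x y. f x (of_real q * y))"

text \<open>
  The action of \<open>\<Sum>p. a p * (T * E\<^sub>x * E\<^sub>y) ^ p\<close> on \<open>f\<close>, evaluated at \<open>(x, y)\<close>. The coefficients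
  \<open>a p\<close> are numbers here, so they are not shifted even when instantiated by expressions in
  \<open>x\<close> and \<open>y\<close>.
\<close>

definition qshift_series ::
  "real \<Rightarrow> (nat \<Rightarrow> complex) \<Rightarrow> complex \<Rightarrow> (complex \<Rightarrow> complex \<Rightarrow> complex) \<Rightarrow> complex \<Rightarrow> complex \<Rightarrow> complex" where
  "qshift_series q a T f x y =
     (\<Sum>\<^sub>\<infinity>p\<in>UNIV. a p * T ^ p * ((qshift_x q \<circ> qshift_y q) ^^ p) f x y)"

end

theory Submission
  imports Defs
begin

text \<open>
  Grouping the right-hand side by the total power \<open>N = P + p\<close> of \<open>z\<close>, where \<open>P\<close> indexes the operator
  series and \<open>p\<close> the function it acts on, the integrals over \<open>u\<close>, \<open>v\<close> and \<open>w\<close> separate. The \<open>w\<close>-integral is a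
  q-beta integral. The \<open>u\<close>- and \<open>v\<close>-integrals are instances of a q-analogue of Erdelyi's integral
  for a \<open>\<^sub>2\<phi>\<^sub>1\<close>: up to the factors \<open>(q\<^sup>\<lambda>)\<^sub>P\<close> and \<open>(q\<^sup>\<beta>\<^sup>-\<^sup>\<lambda>)\<^sub>p\<close> their values depend only on \<open>N\<close>. What is left of
  the sum over \<open>P + p = N\<close> is a q-Vandermonde convolution, which restores \<open>(q\<^sup>\<alpha>)\<^sub>N\<close>. All interchanges of
  summation are justified by bounding every shifted factorial and its inverse, leaving products of
  geometric series.
\<close>

text \<open>The value of the Erdelyi-type integral does not involve the shift parameter
  \<open>s\<close>. Since (s)_(P+M) = (s)_P (s q^P)_M, the indices P and p can be moved into
  \<open>s\<close> and \<open>b\<close>, and only b q^(P+p) survives in the value. In the u-integral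
  the split-off factors (q^lam3)_P and (q^(beta1-lam3))_p cancel against the third lower parameter
  of phi3 and the third lower parameter of the inner Saran function. In the v-integral the
  corresponding factors (q^eta2)_P and (q^(alpha2-eta2))_p remain; with the power q^((alpha2-eta2)P)
  of the operator argument they form the convolution.

  The obstacle is uniformity: at u = q^i the parameters 1/u and q/(ux) are unbounded, so their
  shifted factorials have no bound independent of i. Reversing the finite products turns the
  quotient of the two into x^M times bounded factors, and only then do the geometric estimates
  apply.\<close>

subsection \<open>Unordered sums\<close>

lemma has_sum_prodD:
  fixes f :: "'a \<times> 'b \<Rightarrow> complex"
  assumes "(f has_sum S) UNIV" "\<And>x. ((\<lambda>y. f (x, y)) has_sum g x) UNIV"
  shows "(g has_sum S) UNIV"
  using assms has_sum_SigmaD[where f = f and A = UNIV and B = "\<lambda>_. UNIV" and S = S and g = g]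
    by simp

lemma summable_on_mult_prod:
  fixes f :: "'a \<Rightarrow> complex" and g :: "'b \<Rightarrow> complex"
  assumes "f summable_on A" "g summable_on B"
  shows "(\<lambda>(x, y). f x * g y) summable_on A \<times> B"
proof -
  have f: "(\<lambda>x. norm (f x)) summable_on A" and g: "(\<lambda>x. norm (g x)) summable_on B"
    using assms by (simp_all add: summable_on_iff_abs_summable_on_complex)
  have "(\<lambda>xy. norm (case xy of (x, y) \<Rightarrow> f x * g y)) summable_on A \<times> B"
    unfolding Infinite_Sum.abs_summable_on_Sigma_iff
    using f g
    by (auto simp: norm_mult infsum_cmult_right' abs_mult infsum_nonneg
             intro!: summable_on_cmult_right summable_on_cmult_left)
  then show ?thesis
    by (rule abs_summable_summable)
qed

lemma has_sum_mult_prod: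
  fixes f :: "'a \<Rightarrow> complex" and g :: "'b \<Rightarrow> complex"
  assumes "(f has_sum s) A" "(g has_sum t) B"
  shows "((\<lambda>(x, y). f x * g y) has_sum s * t) (A \<times> B)"
proof (rule has_sum_SigmaI)
  show "(\<lambda>(x, y). f x * g y) summable_on A \<times> B"
    using assms by (intro summable_on_mult_prod) (auto simp: has_sum_iff)
  show "((\<lambda>x. f x * t) has_sum s * t) A"
    using assms(1) by (rule has_sum_cmult_left)
qed (use assms(2) in \<open>auto intro: has_sum_cmult_right\<close>)

lemma summable_on_bounded_mult:
  fixes g w :: "'a \<Rightarrow> complex"
  assumes "bounded (range g)" "w summable_on UNIV"
  shows "(\<lambda>x. g x * w x) summable_on UNIV"
proof -
  obtain C where C: "\<And>x. norm (g x) \<le> C"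
    using assms(1) by (auto simp: bounded_iff)
  have "(\<lambda>x. norm (w x)) summable_on UNIV"
    using assms(2) by (simp add: summable_on_iff_abs_summable_on_complex)
  then have "(\<lambda>x. C * norm (w x)) summable_on UNIV"
    by (rule summable_on_cmult_right)
  then have "(\<lambda>x. norm (g x * w x)) summable_on UNIV"
    by (rule Infinite_Sum.abs_summable_on_comparison_test') (auto simp: norm_mult intro:
      mult_right_mono C)
  then show ?thesis
    by (rule abs_summable_summable)
qed

lemma summable_on_geometric:
  fixes z :: complex
  assumes "norm z < 1"
  shows "(\<lambda>n. z ^ n) summable_on UNIV"
  by (rule norm_summable_imp_summable_on) (use assms in \<open>auto simp: norm_power\<close>)

lemma summable_on_power3:
  fixes x y z :: complex
  assumes "norm x < 1" "norm y < 1" "norm z < 1"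
  shows "(\<lambda>(m, n, p). x ^ m * (y ^ n * z ^ p)) summable_on UNIV"
proof -
  have 1: "(\<lambda>(n, p). y ^ n * z ^ p) summable_on UNIV \<times> UNIV"
    by (intro summable_on_mult_prod summable_on_geometric assms)
  show ?thesis
    using summable_on_mult_prod[OF summable_on_geometric[OF assms(1)] 1] by (simp add:
      case_prod_unfold)
qed

text \<open>The weight of the fourfold series \<open>T\<close> in \<open>erdelyi_has_sum_0\<close>:
  once factorials and powers of q are bounded, M and r carry x, k carries B, and m carries x
  s.\<close>

lemma summable_on_power4:
  fixes x s B :: complex
  assumes "norm x < 1" "norm (x * s) < 1" "norm B < 1"
  shows "(\<lambda>((M, k), (r, m)). (x ^ M * B ^ k) * (x ^ r * (x * s) ^ m)) summable_on (UNIV ::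
    ((nat \<times> nat) \<times> (nat \<times> nat)) set)"
proof -
  have 1: "(\<lambda>(M, k). x ^ M * B ^ k) summable_on UNIV \<times> UNIV"
    by (intro summable_on_mult_prod summable_on_geometric assms)
  have 2: "(\<lambda>(r, m). x ^ r * (x * s) ^ m) summable_on UNIV \<times> UNIV"
    by (intro summable_on_mult_prod summable_on_geometric assms)
  show ?thesis
    using summable_on_mult_prod[OF 1 2] by (simp add: case_prod_unfold)
qed

lemma bounded_range_mult:
  fixes f g :: "'a \<Rightarrow> complex"
  assumes "bounded (range f)" "bounded (range g)"
  shows "bounded (range (\<lambda>x. f x * g x))"
proof -
  obtain C D where "\<And>x. norm (f x) \<le> C" "\<And>x. norm (g x) \<le> D"
    using assms by (auto simp: bounded_iff)
  then have "norm (f x * g x) \<le> C * D" for x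
    unfolding norm_mult by (intro mult_mono) (auto intro: order_trans[OF norm_ge_zero])
  then show ?thesis
    by (auto simp: bounded_iff)
qed

lemma bounded_range_const: "bounded (range (\<lambda>_. c :: complex))"
  by (auto simp: bounded_iff)

lemma bounded_range_power:
  fixes z :: complex
  assumes "norm z \<le> 1"
  shows "bounded (range (\<lambda>x. z ^ h x))"
  unfolding bounded_iff
  by (intro exI[of _ 1]) (use assms in \<open>auto simp: norm_power intro: power_le_one\<close>)

lemma bounded_range_comp:
  assumes "bounded (range f)"
  shows "bounded (range (\<lambda>x. f (h x)))"
  using assms by (rule bounded_subset) auto

text \<open>One constant C serves for all pairs (x, y), so C times the sum of the norms of
  \<open>w\<close> bounds every inner series. This uniformity in the parameters is what
  \<open>erdelyi_term_bounded\<close> requires.\<close>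

lemma bounded_range_infsum:
  fixes g :: "'a \<Rightarrow> 'b \<Rightarrow> complex" and w :: "'b \<Rightarrow> complex"
  assumes "bounded (range (\<lambda>(x, y). g x y))" "w summable_on UNIV"
  shows "bounded (range (\<lambda>x. \<Sum>\<^sub>\<infinity>y. g x y * w y))"
proof -
  obtain C where C: "\<And>x y. norm (g x y) \<le> C"
    using assms(1) by (auto simp: bounded_iff)
  have w: "(\<lambda>x. norm (w x)) summable_on UNIV"
    using assms(2) by (simp add: summable_on_iff_abs_summable_on_complex)
  then have Cw: "(\<lambda>x. C * norm (w x)) summable_on UNIV"
    by (rule summable_on_cmult_right)
  have "norm (\<Sum>\<^sub>\<infinity>y. g x y * w y) \<le> (\<Sum>\<^sub>\<infinity>y. C * norm (w y))" for x
  proof -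
    have gw: "(\<lambda>y. norm (g x y * w y)) summable_on UNIV"
      using Cw by (rule Infinite_Sum.abs_summable_on_comparison_test') (auto simp:
        norm_mult intro: mult_right_mono C)
    then have "norm (\<Sum>\<^sub>\<infinity>y. g x y * w y) \<le> (\<Sum>\<^sub>\<infinity>y. norm (g x y * w y))"
      by (rule norm_infsum_bound)
    also have "\<dots> \<le> (\<Sum>\<^sub>\<infinity>y. C * norm (w y))"
      using gw Cw by (rule infsum_mono) (auto simp: norm_mult intro: mult_right_mono C)
    finally show ?thesis .
  qed
  then show ?thesis
    by (auto simp: bounded_iff)
qed

subsection \<open>Shifted factorials\<close>

lemma qpoch_0 [simp]: "qpoch a q 0 = 1"
  by (simp add: qpoch_def)

lemma qpoch_Suc: "qpoch a q (Suc n) = qpoch a q n * (1 - a * of_real q ^ n)"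
  by (simp add: qpoch_def)

lemma qpoch_add: "qpoch a q (m + n) = qpoch a q m * qpoch (a * of_real q ^ m) q n"
  by (induction n) (simp_all add: qpoch_Suc power_add mult.assoc)

text \<open>The induction step splits \<open>1 - q ^ (n + 1)\<close> as \<open>(1 - q ^ (n + 1 - k)) + q ^ (n + 1 - k) * (1 - q ^ k)\<close>.\<close>

lemma qpoch_convolution:
  assumes "\<And>n. qpoch (of_real q) q n \<noteq> 0"
  shows "(\<Sum>k\<le>n. qpoch a q k * b ^ k * qpoch b q (n - k) /
            (qpoch (of_real q) q k * qpoch (of_real q) q (n - k))) =
         qpoch (a * b) q n / qpoch (of_real q) q n"
proof (induction n)
  case 0
  then show ?case by simp
next
  case (Suc n)
  define Q where "Q = complex_of_real q"
  define R where "R = qpoch Q q"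
  define t where "t n k = qpoch a q k * b ^ k * qpoch b q (n - k) / (R k * R (n - k))" for n k
  have R0: "R k \<noteq> 0" for k
    using assms by (simp add: R_def Q_def)
  have RSuc: "R (Suc k) = R k * (1 - Q ^ Suc k)" for k
    by (simp add: R_def qpoch_Suc Q_def)
  have Q0: "1 - Q ^ Suc k \<noteq> 0" for k
    using R0[of "Suc k"] by (auto simp: RSuc)
  have IH: "(\<Sum>k\<le>n. t n k) = qpoch (a * b) q n / R n"
    using Suc.IH by (simp add: t_def R_def Q_def)
  have s1: "(\<Sum>k\<le>Suc n. t (Suc n) k * (1 - Q ^ (Suc n - k))) = (\<Sum>k\<le>n. t n k * (1 - b * Q ^ (n - k)))"
  proof -
    have "(\<Sum>k\<le>Suc n. t (Suc n) k * (1 - Q ^ (Suc n - k))) = (\<Sum>k\<le>n. t (Suc n) k *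
      (1 - Q ^ (Suc n - k)))"
      by simp
    also have "\<dots> = (\<Sum>k\<le>n. t n k * (1 - b * Q ^ (n - k)))"
    proof (rule sum.cong)
      fix k assume "k \<in> {..n}"
      then have e: "Suc n - k = Suc (n - k)" by auto
      show "t (Suc n) k * (1 - Q ^ (Suc n - k)) = t n k * (1 - b * Q ^ (n - k))"
        using R0 Q0[of "n - k"] by (simp add: t_def e RSuc qpoch_Suc[of b] Q_def[symmetric])
    qed simp
    finally show ?thesis .
  qed
  \<comment> \<open>The term k = 0 vanishes through 1 - Q^0, so the index can be shifted by one; in
    \<open>s1\<close> it is the last term that vanishes.\<close>
  have s2: "(\<Sum>k\<le>Suc n. t (Suc n) k * (Q ^ (Suc n - k) * (1 - Q ^ k))) =
            (\<Sum>k\<le>n. t n k * (b * Q ^ (n - k) * (1 - a * Q ^ k)))"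
  proof -
    have "(\<Sum>k\<le>Suc n. t (Suc n) k * (Q ^ (Suc n - k) * (1 - Q ^ k))) =
          (\<Sum>k\<le>n. t (Suc n) (Suc k) * (Q ^ (n - k) * (1 - Q ^ Suc k)))"
      by (subst sum.atMost_Suc_shift) simp
    also have "\<dots> = (\<Sum>k\<le>n. t n k * (b * Q ^ (n - k) * (1 - a * Q ^ k)))"
      using R0 Q0 by (intro sum.cong refl) (simp add: t_def RSuc qpoch_Suc[of a] Q_def[symmetric])
    finally show ?thesis .
  qed
  have "(1 - Q ^ Suc n) * (\<Sum>k\<le>Suc n. t (Suc n) k) =
        (\<Sum>k\<le>Suc n. t (Suc n) k * (1 - Q ^ (Suc n - k)) + t (Suc n) k * (Q ^ (Suc n - k) *
          (1 - Q ^ k)))"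
    unfolding sum_distrib_left
  proof (rule sum.cong)
    fix k assume "k \<in> {..Suc n}"
    then have "Q ^ Suc n = Q ^ (Suc n - k) * Q ^ k"
      by (simp flip: power_add)
    then show "(1 - Q ^ Suc n) * t (Suc n) k =
        t (Suc n) k * (1 - Q ^ (Suc n - k)) + t (Suc n) k * (Q ^ (Suc n - k) * (1 - Q ^ k))"
      by (simp add: algebra_simps)
  qed simp
  also have "\<dots> = (\<Sum>k\<le>n. t n k * (1 - b * Q ^ (n - k)) + t n k * (b * Q ^ (n - k) * (1 - a *
    Q ^ k)))"
    by (simp only: sum.distrib s1 s2)
  also have "\<dots> = (\<Sum>k\<le>n. t n k * (1 - a * b * Q ^ n))"
  proof (rule sum.cong)
    fix k assume "k \<in> {..n}"
    then have "Q ^ n = Q ^ (n - k) * Q ^ k"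
      by (simp flip: power_add)
    then show "t n k * (1 - b * Q ^ (n - k)) + t n k * (b * Q ^ (n - k) * (1 - a * Q ^ k)) =
               t n k * (1 - a * b * Q ^ n)"
      by (simp add: algebra_simps)
  qed simp
  also have "\<dots> = qpoch (a * b) q n / R n * (1 - a * b * Q ^ n)"
    by (simp only: IH flip: sum_distrib_right)
  finally have "(\<Sum>k\<le>Suc n. t (Suc n) k) = qpoch (a * b) q (Suc n) / R (Suc n)"
    using Q0[of n] R0[of n] by (simp add: RSuc qpoch_Suc[of "a * b"] field_simps Q_def[symmetric])
  then show ?case
    by (simp add: t_def R_def Q_def)
qed

subsection \<open>Basic hypergeometric series\<close>

definition phi21 :: "real \<Rightarrow> complex \<Rightarrow> complex \<Rightarrow> complex \<Rightarrow> complex \<Rightarrow> complex" where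
  "phi21 q a b c x =
     (\<Sum>\<^sub>\<infinity>n. qpoch a q n * qpoch b q n / (qpoch c q n * qpoch (of_real q) q n) * x ^ n)"

text \<open>
  The value at \<open>u = q\<^sup>i\<close> of the \<open>u\<close>-integrand, weight included, with \<open>B = q\<^sup>\<gamma>\<^sup>-\<^sup>\<lambda>\<close> and \<open>l = q\<^sup>\<lambda>\<close> for the
  measure and \<open>s = q\<^sup>\<lambda>\<^sup>'\<close> for the shift; \<open>P\<close> and \<open>p\<close> are the summation indices that couple it to the
  other two integrals.
\<close>

definition erdelyi_term ::
  "real \<Rightarrow> complex \<Rightarrow> complex \<Rightarrow> complex \<Rightarrow> complex \<Rightarrow> complex \<Rightarrow> complex \<Rightarrow> nat \<Rightarrow> nat \<Rightarrow> nat \<Rightarrow> complex"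
where
  "erdelyi_term q a b B l s x P p i =
     qpoch_inf B q / qpoch_inf (B * l) q * B ^ i * qpoch l q i / qpoch (of_real q) q i *
     (qpoch_inf (of_real q ^ i * x * s) q / qpoch_inf (of_real q ^ i * x) q) /
     qpoch (of_real q ^ i * x * s) q P *
     (\<Sum>\<^sub>\<infinity>M. qpoch s q (P + M) *
        (qpoch (a / B) q M * qpoch (inverse (of_real q ^ i)) q M /
          (qpoch l q M * qpoch (of_real q / (of_real q ^ i * x)) q M)) *
        (of_real q ^ M / qpoch (of_real q) q M)) *
     (\<Sum>\<^sub>\<infinity>m. qpoch a q m * qpoch (b / s) q (m + p) / (qpoch B q m * qpoch (of_real q) q m) *
        (of_real q ^ i * x * s * of_real q ^ P) ^ m)"

lemma qshift_funpow:
  "((qshift_x q \<circ> qshift_y q) ^^ p) f x y = f (of_real q ^ p * x) (of_real q ^ p * y)"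
  by (induction p arbitrary: x y) (simp_all add: qshift_x_def qshift_y_def mult_ac)

context
  fixes q :: real
  assumes q_pos: "0 < q" and q_less: "q < 1"
begin

lemma norm_q_power_le: "norm (complex_of_real q ^ n) \<le> 1"
  using q_pos q_less by (simp add: norm_power power_le_one)

lemma norm_mult_q_power_less:
  fixes z :: complex
  assumes "norm z < 1"
  shows "norm (z * of_real q ^ n) < 1"
proof -
  have "norm (z * of_real q ^ n) \<le> norm z"
    unfolding norm_mult using norm_q_power_le[of n] by (simp add: mult_left_le)
  with assms show ?thesis by simp
qed

lemma qpoch_nonzero:
  assumes "norm a < 1"
  shows "qpoch a q n \<noteq> 0"
proof -
  have "1 - a * of_real q ^ j \<noteq> 0" for j
  proof
    assume "1 - a * of_real q ^ j = 0"
    then have "norm (a * of_real q ^ j) = 1" by simp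
    then show False using norm_mult_q_power_less[OF assms, of j] by simp
  qed
  then show ?thesis
    by (simp add: qpoch_def)
qed

lemma qpoch_q_nonzero: "qpoch (of_real q) q n \<noteq> 0"
  by (rule qpoch_nonzero) (use q_pos q_less in auto)

lemma convergent_prod_qpoch: "convergent_prod (\<lambda>j. 1 - (a :: complex) * of_real q ^ j)"
proof -
  have "summable (\<lambda>j. norm ((1 - a * of_real q ^ j) - 1))"
    using q_pos q_less by (auto simp: norm_mult norm_power intro!: summable_mult summable_geometric)
  then have "abs_convergent_prod (\<lambda>j. 1 - a * of_real q ^ j)"
    by (rule summable_imp_abs_convergent_prod)
  then show ?thesis
    by (rule abs_convergent_prod_imp_convergent_prod)
qed

lemma qpoch_tendsto: "qpoch a q \<longlonglongrightarrow> qpoch_inf a q"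
proof -
  have "(\<lambda>n. qpoch a q (Suc n)) \<longlonglongrightarrow> qpoch_inf a q"
    using convergent_prod_LIMSEQ[OF convergent_prod_qpoch[of a]]
    by (simp add: qpoch_def qpoch_inf_def lessThan_Suc_atMost)
  then show ?thesis
    by (simp only: filterlim_sequentially_Suc)
qed

lemma qpoch_inf_nonzero:
  assumes "\<And>n. qpoch a q n \<noteq> 0"
  shows "qpoch_inf a q \<noteq> 0"
proof -
  have "1 - a * of_real q ^ n \<noteq> 0" for n
    using assms[of "Suc n"] by (simp add: qpoch_Suc)
  then show ?thesis
    unfolding qpoch_inf_def by (intro prodinf_nonzero convergent_prod_qpoch)
qed

lemma qpoch_inf_nonzero': "norm a < 1 \<Longrightarrow> qpoch_inf a q \<noteq> 0"
  by (intro qpoch_inf_nonzero qpoch_nonzero)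

lemma qpoch_inf_split: "qpoch_inf a q = qpoch a q n * qpoch_inf (a * of_real q ^ n) q"
proof (rule LIMSEQ_unique)
  show "(\<lambda>m. qpoch a q (n + m)) \<longlonglongrightarrow> qpoch_inf a q"
    using LIMSEQ_ignore_initial_segment[OF qpoch_tendsto[of a], of n] by (simp add: add.commute)
  show "(\<lambda>m. qpoch a q (n + m)) \<longlonglongrightarrow> qpoch a q n * qpoch_inf (a * of_real q ^ n) q"
    unfolding qpoch_add by (intro tendsto_intros qpoch_tendsto)
qed

lemma qpoch_inf_shift:
  assumes "norm a < 1"
  shows "qpoch_inf (a * of_real q ^ n) q = qpoch_inf a q / qpoch a q n"
  using qpoch_inf_split[of a n] qpoch_nonzero[OF assms, of n] by simp

lemma bounded_range_qpoch: "bounded (range (\<lambda>x. qpoch a q (h x)))"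
  by (rule bounded_range_comp[OF convergent_imp_bounded[OF qpoch_tendsto]])

text \<open>If no factor vanishes, the inverses converge to the inverse of a nonzero infinite
  product. If one vanishes, all later inverses are 0 by the convention \<open>inverse 0 = 0\<close>.
  Hence the bound is available for every \<open>a\<close>.\<close>

lemma bounded_range_inverse_qpoch: "bounded (range (\<lambda>x. inverse (qpoch a q (h x))))"
proof (rule bounded_range_comp[where f = "\<lambda>n. inverse (qpoch a q n)"])
  show "bounded (range (\<lambda>n. inverse (qpoch a q n)))"
  proof (cases "\<forall>n. qpoch a q n \<noteq> 0")
    case True
    then have "(\<lambda>n. inverse (qpoch a q n)) \<longlonglongrightarrow> inverse (qpoch_inf a q)"
      by (intro tendsto_inverse qpoch_tendsto qpoch_inf_nonzero) auto
    then show ?thesis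
      by (rule convergent_imp_bounded)
  next
    case False
    then obtain N where "qpoch a q N = 0" by auto
    then have "qpoch a q n = 0" if "n \<ge> N" for n
      using that qpoch_add[of a q N "n - N"] by simp
    then have "(\<lambda>n. inverse (qpoch a q n)) \<longlonglongrightarrow> 0"
      by (intro tendsto_eventually) (auto simp: eventually_sequentially)
    then show ?thesis
      by (rule convergent_imp_bounded)
  qed
qed

lemmas bounded_range_intros =
  bounded_range_mult bounded_range_const bounded_range_qpoch bounded_range_inverse_qpoch
  bounded_range_power

subsection \<open>The q-binomial theorem\<close>

text \<open>The series f satisfies (1 - z) f(z) = (1 - a z) f(q z). Iteration drives the argument to
  0, where f is continuous with value 1, and leaves the quotient of infinite products.\<close>

lemma q_binomial_theorem:
  assumes z: "norm z < 1"
  shows "((\<lambda>n. qpoch a q n / qpoch (of_real q) q n * z ^ n) has_sum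
          qpoch_inf (a * z) q / qpoch_inf z q) UNIV"
proof -
  define Q where "Q = complex_of_real q"
  define c where "c n = qpoch a q n / qpoch Q q n" for n
  define f where "f z = (\<Sum>\<^sub>\<infinity>n. c n * z ^ n)" for z
  have bc: "bounded (range c)"
    unfolding c_def divide_inverse by (intro bounded_range_intros)
  have sm: "(\<lambda>n. c n * z ^ n) summable_on UNIV" if "norm z < 1" for z
    by (rule summable_on_bounded_mult[OF bc summable_on_geometric[OF that]])
  have hs: "((\<lambda>n. c n * z ^ n) has_sum f z) UNIV" if "norm z < 1" for z
    using sm[OF that] by (simp add: f_def)
  have Qz: "norm (z * Q ^ n) < 1" if "norm z < 1" for z n
    using norm_mult_q_power_less[OF that] by (simp add: Q_def)
  \<comment> \<open>The recurrence of the coefficients, which is \<open>rec\<close> read off at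
    z^(n+1).\<close>
  have cSuc: "c (Suc n) * (1 - Q ^ Suc n) = c n * (1 - a * Q ^ n)" for n
    using qpoch_q_nonzero[of n] qpoch_q_nonzero[of "Suc n"]
    by (auto simp: c_def qpoch_Suc Q_def)
  have rec: "(1 - z) * f z = (1 - a * z) * f (z * Q)" if z: "norm z < 1" for z
  proof -
    have zQ: "norm (z * Q) < 1" using Qz[OF z, of 1] by simp
    have s: "(\<lambda>n. c n * z ^ n) sums f z" "(\<lambda>n. c n * (z * Q) ^ n) sums f (z * Q)"
      using hs[OF z] hs[OF zQ] by (auto intro: has_sum_imp_sums)
    have "(\<lambda>n. c n * z ^ n - c n * (z * Q) ^ n) sums (f z - f (z * Q))"
      using s by (rule sums_diff)
    \<comment> \<open>The constant terms of the two series cancel, so the difference may start at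
      index 1.\<close>
    then have "(\<lambda>n. c (Suc n) * z ^ Suc n - c (Suc n) * (z * Q) ^ Suc n) sums (f z - f (z * Q))"
      by (subst sums_Suc_iff) simp
    also have "(\<lambda>n. c (Suc n) * z ^ Suc n - c (Suc n) * (z * Q) ^ Suc n) =
        (\<lambda>n. z * (c n * z ^ n - a * (c n * (z * Q) ^ n)))"
    proof
      fix n
      have "c (Suc n) * z ^ Suc n - c (Suc n) * (z * Q) ^ Suc n = (c (Suc n) * (1 - Q ^ Suc n)) *
        z ^ Suc n"
        by (simp add: algebra_simps power_mult_distrib)
      also have "\<dots> = z * (c n * z ^ n - a * (c n * (z * Q) ^ n))"
        unfolding cSuc by (simp add: algebra_simps power_mult_distrib)
      finally show "c (Suc n) * z ^ Suc n - c (Suc n) * (z * Q) ^ Suc n =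
        z * (c n * z ^ n - a * (c n * (z * Q) ^ n))" .
    qed
    finally have "(\<lambda>n. z * (c n * z ^ n - a * (c n * (z * Q) ^ n))) sums (f z - f (z * Q))" .
    moreover have "(\<lambda>n. z * (c n * z ^ n - a * (c n * (z * Q) ^ n))) sums (z * (f z - a * f (z *
      Q)))"
      by (intro sums_mult sums_diff s)
    ultimately have "f z - f (z * Q) = z * (f z - a * f (z * Q))"
      by (rule sums_unique2)
    then show ?thesis
      by (simp add: algebra_simps)
  qed
  have iter: "qpoch z q n * f z = qpoch (a * z) q n * f (z * Q ^ n)" for n
  proof (induction n)
    case (Suc n)
    have "qpoch z q (Suc n) * f z = (1 - z * Q ^ n) * (qpoch (a * z) q n * f (z * Q ^ n))"
      by (simp add: qpoch_Suc Q_def Suc.IH[unfolded Q_def, symmetric])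
    also have "\<dots> = qpoch (a * z) q n * ((1 - z * Q ^ n) * f (z * Q ^ n))"
      by simp
    also have "\<dots> = qpoch (a * z) q (Suc n) * f (z * Q ^ Suc n)"
      unfolding rec[OF Qz[OF z, of n]] by (simp add: qpoch_Suc Q_def mult_ac)
    finally show ?case .
  qed simp
  have "(\<lambda>n. z * Q ^ n) \<longlonglongrightarrow> z * 0"
    using q_pos q_less by (intro tendsto_intros LIMSEQ_power_zero) (simp add: Q_def)
  moreover have "isCont f 0"
  proof -
    have "isCont (\<lambda>z. \<Sum>n. c n * z ^ n) 0"
      by (rule isCont_powser[where K = "1/2"]) (use sm[of "1/2"] in \<open>auto intro:
        summable_on_imp_summable\<close>)
    moreover have "eventually (\<lambda>z. (\<Sum>n. c n * z ^ n) = f z) (nhds 0)"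
    proof -
      have "eventually (\<lambda>z. z \<in> ball (0 :: complex) 1) (nhds 0)"
        by (intro eventually_nhds_in_open) auto
      then show ?thesis
        by eventually_elim (use hs[THEN has_sum_imp_sums] in \<open>auto simp: sums_iff\<close>)
    qed
    ultimately show ?thesis
      by (simp add: isCont_cong)
  qed
  ultimately have "(\<lambda>n. f (z * Q ^ n)) \<longlonglongrightarrow> f 0"
    by (intro isCont_tendsto_compose[of 0 f]) auto
  moreover have "f 0 = 1"
  proof -
    have "(\<lambda>n. c n * 0 ^ n) sums f 0"
      by (rule has_sum_imp_sums[OF hs]) simp
    moreover have "(\<lambda>n. c n * 0 ^ n) sums c 0"
      by (rule powser_sums_zero)
    ultimately have "f 0 = c 0"
      by (rule sums_unique2)
    then show ?thesis
      by (simp add: c_def)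
  qed
  ultimately have "(\<lambda>n. qpoch (a * z) q n * f (z * Q ^ n)) \<longlonglongrightarrow> qpoch_inf (a * z) q * 1"
    by (intro tendsto_mult qpoch_tendsto) simp
  moreover have "(\<lambda>n. qpoch z q n * f z) \<longlonglongrightarrow> qpoch_inf z q * f z"
    by (intro tendsto_intros qpoch_tendsto)
  ultimately have "qpoch_inf z q * f z = qpoch_inf (a * z) q"
    unfolding iter by (auto dest: LIMSEQ_unique)
  then have "f z = qpoch_inf (a * z) q / qpoch_inf z q"
    using qpoch_inf_nonzero'[OF z] by (simp add: field_simps)
  then show ?thesis
    using hs[OF z] by (simp add: c_def Q_def)
qed

subsection \<open>A q-analogue of Erdelyi's integral\<close>

text \<open>The negative powers of q in numerator and denominator cancel factor by factor. The
  remaining factors, in reversed order, are those by which (q)_i and (x)_i exceed (q)_(i-M) and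
  (x)_(i-M). This removes the unbounded parameters q^(-i) and q^(1-i)/x.\<close>

lemma qpoch_reverse:
  assumes x: "norm x < 1" "x \<noteq> 0" and "M \<le> i"
  shows "qpoch (inverse (of_real q ^ i)) q M / qpoch (of_real q / (of_real q ^ i * x)) q M *
    of_real q ^ M =
         x ^ M * (qpoch (of_real q) q i * qpoch x q (i - M)) / (qpoch (of_real q) q (i - M) *
           qpoch x q i)"
  using assms(3)
proof (induction M)
  case 0
  then show ?case
    using qpoch_nonzero[OF x(1)] qpoch_q_nonzero by simp
next
  case (Suc M)
  define Q where "Q = complex_of_real q"
  define d where "d = i - Suc M"
  have Q0: "Q \<noteq> 0" using q_pos by (simp add: Q_def)
  have d: "i - M = Suc d" "i - Suc M = d" "i = M + Suc d"
    using Suc.prems by (auto simp: d_def)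
  have n1: "qpoch x q (Suc d) \<noteq> 0" "qpoch Q q (Suc d) \<noteq> 0" "qpoch x q i \<noteq> 0"
    using qpoch_nonzero[OF x(1)] qpoch_q_nonzero by (auto simp: Q_def)
  then have n2: "qpoch x q d \<noteq> 0" "1 - x * Q ^ d \<noteq> 0" "qpoch Q q d \<noteq> 0" "1 - Q * Q ^ d \<noteq> 0"
    by (auto simp: qpoch_Suc Q_def)
  \<comment> \<open>As i = M + d + 1, the new factors are 1 - q^(-d-1) and 1 - q^(-d)/x. Their
    negative powers of q leave 1/q in the quotient, cancelled by the additional \<open>Q\<close> in
    \<open>Q ^ Suc M\<close>.\<close>
  have f1: "1 - inverse (Q ^ i) * Q ^ M = - (1 - Q * Q ^ d) / (Q * Q ^ d)"
    using Q0 by (simp add: d(3) power_add field_simps)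
  have f2: "1 - Q / (Q ^ i * x) * Q ^ M = - (1 - x * Q ^ d) / (x * Q ^ d)"
    using Q0 x by (simp add: d(3) power_add field_simps)
  have fac: "(1 - inverse (Q ^ i) * Q ^ M) / (1 - Q / (Q ^ i * x) * Q ^ M) * Q =
             x * (1 - Q * Q ^ d) / (1 - x * Q ^ d)"
    unfolding f1 f2 using Q0 x n2 by (simp add: divide_simps) (simp add: algebra_simps)
  have "qpoch (inverse (Q ^ i)) q (Suc M) / qpoch (Q / (Q ^ i * x)) q (Suc M) * Q ^ Suc M =
     (qpoch (inverse (Q ^ i)) q M / qpoch (Q / (Q ^ i * x)) q M * Q ^ M) *
     ((1 - inverse (Q ^ i) * Q ^ M) / (1 - Q / (Q ^ i * x) * Q ^ M) * Q)"
    by (simp add: qpoch_Suc Q_def)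
  also have "\<dots> = x ^ M * (qpoch Q q i * qpoch x q (Suc d)) / (qpoch Q q (Suc d) * qpoch x q i) *
     (x * (1 - Q * Q ^ d) / (1 - x * Q ^ d))"
    unfolding fac using Suc.IH Suc.prems by (simp add: Q_def d(1))
  also have "\<dots> = x ^ Suc M * (qpoch Q q i * qpoch x q d) / (qpoch Q q d * qpoch x q i)"
    using n1 n2 by (simp add: qpoch_Suc Q_def[symmetric])
  finally show ?case
    by (simp add: Q_def d(2))
qed

lemma qpoch_inverse_power_eq_0:
  assumes "i < M"
  shows "qpoch (inverse (of_real q ^ i)) q M = 0"
  unfolding qpoch_def using assms q_pos by (intro prod_zero bexI[of _ i]) auto

text \<open>(s)_(P+M) splits off (s)_P, (b/s)_(m+p) splits off (b/s)_p, and the quotient of the new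
  parameters b q^(P+p) and s q^P is (b/s) q^p, as the second series demands. So the summation
  formula need only be proved for P = p = 0.\<close>

lemma erdelyi_term_shift:
  assumes "norm (x * s) < 1"
  shows "erdelyi_term q a b B l s x P p i =
         qpoch s q P * qpoch (b / s) q p *
         erdelyi_term q a (b * of_real q ^ (P + p)) B l (s * of_real q ^ P) x 0 0 i"
proof -
  define Q where "Q = complex_of_real q"
  have Q0: "Q \<noteq> 0" using q_pos by (simp add: Q_def)
  have 1: "qpoch_inf (Q ^ i * x * (s * Q ^ P)) q = qpoch_inf (Q ^ i * x * s) q / qpoch (Q ^ i *
    x * s) q P"
    using qpoch_inf_shift[OF norm_mult_q_power_less[OF assms, of i], of P]
    by (simp add: Q_def mult_ac)
  have 2: "b * Q ^ (P + p) / (s * Q ^ P) = b / s * Q ^ p"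
    using Q0 by (simp add: power_add)
  have 3: "qpoch s q (P + M) = qpoch s q P * qpoch (s * Q ^ P) q M" for M
    by (simp add: qpoch_add Q_def)
  have 4: "qpoch (b / s) q (m + p) = qpoch (b / s) q p * qpoch (b / s * Q ^ p) q m" for m
    by (subst add.commute) (simp add: qpoch_add Q_def)
  have 5: "(\<Sum>\<^sub>\<infinity>M. qpoch s q (P + M) *
        (qpoch (a / B) q M * qpoch (inverse (Q ^ i)) q M / (qpoch l q M * qpoch (Q / (Q ^ i * x))
          q M)) *
        (Q ^ M / qpoch Q q M)) = qpoch s q P * (\<Sum>\<^sub>\<infinity>M. qpoch (s * Q ^ P) q M *
        (qpoch (a / B) q M * qpoch (inverse (Q ^ i)) q M / (qpoch l q M * qpoch (Q / (Q ^ i * x))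
          q M)) *
        (Q ^ M / qpoch Q q M))"
    unfolding infsum_cmult_right'[symmetric] 3 by (simp add: mult.assoc)
  have 6: "(\<Sum>\<^sub>\<infinity>m. qpoch a q m * qpoch (b / s) q (m + p) / (qpoch B q m * qpoch Q q m) * (Q ^ i *
    x * s * Q ^ P) ^ m) =
    qpoch (b / s) q p * (\<Sum>\<^sub>\<infinity>m. qpoch a q m * qpoch (b / s * Q ^ p) q m / (qpoch B q m *
      qpoch Q q m) * (Q ^ i * x * (s * Q ^ P)) ^ m)"
    unfolding infsum_cmult_right'[symmetric] 4 by (rule infsum_cong) (simp add: mult_ac)
  show ?thesis
    unfolding erdelyi_term_def Q_def[symmetric] 1 2 5 6
    by (simp add: mult_ac)
qed

text \<open>The form used for summation and for estimates. The reversal contributes (q)_i/(x)_i;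
  this cancels the 1/(q)_i of the weight and the (x)_i coming from 1/(x q^i)_\<infinity>. Apart from
  B^i, only factors with bounds uniform in i remain.\<close>

lemma erdelyi_term_expand:
  assumes x: "norm x < 1" "x \<noteq> 0" and xs: "norm (x * s) < 1"
  shows "erdelyi_term q a b B l s x P p i =
     qpoch_inf B q / qpoch_inf (B * l) q * B ^ i * qpoch l q i *
     (qpoch_inf (x * s) q / (qpoch (x * s) q (i + P) * qpoch_inf x q)) *
     (\<Sum>M\<le>i. qpoch s q (P + M) * qpoch (a / B) q M * qpoch x q (i - M) /
        (qpoch l q M * qpoch (of_real q) q M * qpoch (of_real q) q (i - M)) * x ^ M) *
     (\<Sum>\<^sub>\<infinity>m. qpoch a q m * qpoch (b / s) q (m + p) / (qpoch B q m * qpoch (of_real q) q m) *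
        (x * s * of_real q ^ (i + P)) ^ m)"
proof -
  define Q where "Q = complex_of_real q"
  have R0: "qpoch Q q n \<noteq> 0" for n
    using qpoch_q_nonzero by (simp add: Q_def)
  have x0: "qpoch x q n \<noteq> 0" for n
    by (rule qpoch_nonzero[OF x(1)])
  have "(\<Sum>\<^sub>\<infinity>M. qpoch s q (P + M) *
        (qpoch (a / B) q M * qpoch (inverse (Q ^ i)) q M / (qpoch l q M * qpoch (Q / (Q ^ i * x))
          q M)) *
        (Q ^ M / qpoch Q q M)) =
      (\<Sum>\<^sub>\<infinity>M\<in>{..i}. qpoch s q (P + M) * qpoch (a / B) q M /
        (qpoch l q M * qpoch Q q M) *
        (qpoch (inverse (Q ^ i)) q M / qpoch (Q / (Q ^ i * x)) q M * Q ^ M))"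
    by (rule infsum_cong_neutral)
       (auto simp: qpoch_inverse_power_eq_0 Q_def mult_ac)
  also have "\<dots> = (\<Sum>M\<le>i. qpoch s q (P + M) * qpoch (a / B) q M /
        (qpoch l q M * qpoch Q q M) *
        (x ^ M * (qpoch Q q i * qpoch x q (i - M)) / (qpoch Q q (i - M) * qpoch x q i)))"
    unfolding infsum_finite[OF finite_atMost]
    by (intro sum.cong refl) (simp only: qpoch_reverse[OF x] Q_def atMost_iff)
  also have "\<dots> = qpoch Q q i / qpoch x q i * (\<Sum>M\<le>i. qpoch s q (P + M) * qpoch (a / B) q M *
    qpoch x q (i - M) /
        (qpoch l q M * qpoch Q q M * qpoch Q q (i - M)) * x ^ M)"
    unfolding sum_distrib_left by (intro sum.cong) (auto simp: field_simps)
  finally have 1: "(\<Sum>\<^sub>\<infinity>M. qpoch s q (P + M) *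
        (qpoch (a / B) q M * qpoch (inverse (Q ^ i)) q M / (qpoch l q M * qpoch (Q / (Q ^ i * x))
          q M)) *
        (Q ^ M / qpoch Q q M)) = qpoch Q q i / qpoch x q i * (\<Sum>M\<le>i. qpoch s q (P + M) * qpoch (a /
          B) q M * qpoch x q (i - M) /
        (qpoch l q M * qpoch Q q M * qpoch Q q (i - M)) * x ^ M)" .
  have 2: "qpoch_inf (Q ^ i * x) q = qpoch_inf x q / qpoch x q i"
    using qpoch_inf_shift[OF x(1), of i] by (simp add: Q_def mult.commute)
  have 3: "qpoch_inf (Q ^ i * x * s) q = qpoch_inf (x * s) q / qpoch (x * s) q i"
    using qpoch_inf_shift[OF xs, of i] by (simp add: Q_def mult_ac)
  have 4: "qpoch (x * s) q (i + P) = qpoch (x * s) q i * qpoch (Q ^ i * x * s) q P"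
    by (simp add: qpoch_add Q_def mult_ac)
  have 5: "Q ^ i * x * s * Q ^ P = x * s * Q ^ (i + P)"
    by (simp add: power_add mult_ac)
  show ?thesis
    unfolding erdelyi_term_def Q_def[symmetric] 1 2 3 4 5
    using R0[of i] x0[of i] by (simp add: mult_ac)
qed

text \<open>
  With the factor \<open>(x s q\<^sup>i)\<^sub>\<infinity> / (x q\<^sup>k)\<^sub>\<infinity>\<close>, \<open>i = M + k\<close>, expanded by the q-binomial theorem, the sum over
  \<open>k\<close> is again a q-binomial series, and the coefficient of \<open>x\<^sup>n\<close> that remains is a double convolution.
\<close>

lemma erdelyi_has_sum_0:
  assumes x: "norm x < 1" "x \<noteq> 0" and xs: "norm (x * s) < 1" and s: "s \<noteq> 0"
    and B: "norm B < 1" "B \<noteq> 0" and l: "norm l < 1"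
  shows "(erdelyi_term q a b B l s x 0 0 has_sum phi21 q a b (B * l) x) UNIV"
proof -
  define Q where "Q = complex_of_real q"
  define R where "R = qpoch Q q"
  define K where "K = qpoch_inf B q / qpoch_inf (B * l) q"
  have Q1: "norm Q \<le> 1" using q_pos q_less by (simp add: Q_def)
  have Bl: "norm (B * l) < 1"
    using norm_mult_less[OF B(1) l] by simp
  have nz: "qpoch x q n \<noteq> 0" "qpoch (x * s) q n \<noteq> 0" "qpoch B q n \<noteq> 0" "qpoch l q n \<noteq> 0"
    "qpoch (B * l) q n \<noteq> 0" for n
    using x xs B l Bl by (simp_all add: qpoch_nonzero)
  have nzi: "qpoch_inf x q \<noteq> 0" "qpoch_inf B q \<noteq> 0" "qpoch_inf (B * l) q \<noteq> 0"
    using x B Bl by (simp_all add: qpoch_inf_nonzero')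
  define e where "e M k = K * B ^ (M + k) * qpoch l q (M + k) * qpoch s q M * qpoch (a / B) q M /
     (qpoch l q M * R M * R k) * x ^ M" for M k
  define f where "f m = qpoch a q m * qpoch (b / s) q m / (qpoch B q m * R m)" for m
  \<comment> \<open>Both sides evaluate this absolutely convergent fourfold series. Summing r and m
    first gives \<open>g\<close>, whose sum over M + k = i is the i-th Erdelyi term; summing k first
    gives \<open>h\<close>, whose sum over M + r + m = n is the n-th term of the 2phi1
    series.\<close>
  define T where "T = (\<lambda>((M, k), (r, m)). e M k *
     (qpoch (s * Q ^ M) q r / R r * (x * Q ^ k) ^ r * (f m * (x * s * Q ^ (M + k)) ^ m)))"
  define g where "g = (\<lambda>(M, k). e M k *
     (qpoch_inf (x * s * Q ^ (M + k)) q / qpoch_inf (x * Q ^ k) q * phi21 q a (b / s) B (x * s *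
       Q ^ (M + k))))"
  define h where "h = (\<lambda>(M, r, m). qpoch (a / B) q M * B ^ M * qpoch s q (M + r) * qpoch a q m *
    qpoch (b / s) q m *
     qpoch B q (r + m) * Q ^ (M * m) * s ^ m /
     (R M * R r * R m * qpoch B q m * qpoch (B * l) q (M + r + m)) * x ^ (M + r + m))"
  have Tsum: "T summable_on UNIV"
  proof -
    define w where "w = (\<lambda>((M::nat, k::nat), (r::nat, m::nat)). (x ^ M * B ^ k) * (x ^ r * (x * s)
      ^ m))"
    define c where "c = (\<lambda>y::((nat \<times> nat) \<times> (nat \<times> nat)). K * B ^ fst (fst y) *
      qpoch l q (fst (fst y) + snd (fst y)) * 
       qpoch (a / B) q (fst (fst y)) * inverse (qpoch l q (fst (fst y))) *
         inverse (qpoch Q q (fst (fst y))) *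
       inverse (qpoch Q q (snd (fst y))) * qpoch s q (fst (fst y) + fst (snd y)) *
         inverse (qpoch Q q (fst (snd y))) *
       Q ^ (snd (fst y) * fst (snd y)) * qpoch a q (snd (snd y)) * qpoch (b / s) q (snd (snd y)) *
       inverse (qpoch B q (snd (snd y))) * inverse (qpoch Q q (snd (snd y))) *
       Q ^ ((fst (fst y) + snd (fst y)) * snd (snd y)))"
    have "bounded (range c)"
      unfolding c_def by (intro bounded_range_intros) (use B Q1 in auto)
    moreover have "w summable_on UNIV"
      unfolding w_def by (rule summable_on_power4[OF x(1) xs B(1)])
    ultimately have "(\<lambda>y. c y * w y) summable_on UNIV"
      by (rule summable_on_bounded_mult)
    also have "(\<lambda>y. c y * w y) = T"
    proof
      fix y :: "(nat \<times> nat) \<times> (nat \<times> nat)"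
      obtain M k r m where y: "y = ((M, k), (r, m))"
        by (metis surj_pair)
      show "c y * w y = T y"
        by (simp add: y T_def c_def w_def e_def f_def R_def divide_inverse qpoch_add[of s]
          Q_def[symmetric]
               power_add power_mult_distrib add_mult_distrib add_mult_distrib2 mult_ac flip:
                 power_mult)
    qed
    finally show ?thesis .
  qed
  define S where "S = infsum T UNIV"
  have T: "(T has_sum S) UNIV"
    using Tsum by (simp add: S_def)
  have phi: "((\<lambda>m. f m * y ^ m) has_sum phi21 q a (b / s) B y) UNIV" if "norm y < 1" for y
  proof -
    have "(\<lambda>m. f m * y ^ m) summable_on UNIV"
      unfolding f_def R_def divide_inverse inverse_mult_distrib
      by (intro summable_on_bounded_mult summable_on_geometric that bounded_range_intros)
    then show ?thesis
      by (simp add: phi21_def f_def R_def Q_def)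
  qed
  have "(g has_sum S) UNIV"
  proof (rule has_sum_prodD[OF T])
    fix Mk :: "nat \<times> nat"
    obtain M k where Mk: "Mk = (M, k)" by force
    have "((\<lambda>r. qpoch (s * Q ^ M) q r / R r * (x * Q ^ k) ^ r) has_sum
           qpoch_inf (s * Q ^ M * (x * Q ^ k)) q / qpoch_inf (x * Q ^ k) q) UNIV"
      unfolding R_def Q_def by (intro q_binomial_theorem norm_mult_q_power_less x)
    moreover have "((\<lambda>m. f m * (x * s * Q ^ (M + k)) ^ m) has_sum phi21 q a (b / s) B (x * s *
      Q ^ (M + k))) UNIV"
      unfolding Q_def by (intro phi norm_mult_q_power_less xs)
    ultimately have "((\<lambda>(r, m). qpoch (s * Q ^ M) q r / R r * (x * Q ^ k) ^ r * (f m * (x * s *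
      Q ^ (M + k)) ^ m)) has_sum
       qpoch_inf (s * Q ^ M * (x * Q ^ k)) q / qpoch_inf (x * Q ^ k) q * phi21 q a (b / s) B (x *
         s * Q ^ (M + k))) (UNIV \<times> UNIV)"
      by (rule has_sum_mult_prod)
    also have "s * Q ^ M * (x * Q ^ k) = x * s * Q ^ (M + k)"
      by (simp add: power_add mult_ac)
    finally show "((\<lambda>rm. T (Mk, rm)) has_sum g Mk) UNIV"
      unfolding Mk T_def g_def case_prod_unfold fst_conv snd_conv UNIV_Times_UNIV
      by (rule has_sum_cmult_right)
  qed
  then have "((\<lambda>(i, M). g (M, i - M)) has_sum S) (Sigma UNIV (\<lambda>i. {..i}))"
    by (subst (asm) has_sum_reindex_bij_witness[of UNIV "\<lambda>(i, M). (M, i - M)" "\<lambda>(M, k). (M + k, M)"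
          "Sigma UNIV (\<lambda>i. {..i})" "\<lambda>(i, M). g (M, i - M)" g S S]) auto
  then have 1: "((\<lambda>i. \<Sum>M\<le>i. g (M, i - M)) has_sum S) UNIV"
    by (rule has_sum_SigmaD) auto
  have "(\<Sum>M\<le>i. g (M, i - M)) = erdelyi_term q a b B l s x 0 0 i" for i
  proof -
    have "g (M, i - M) = K * B ^ i * qpoch l q i *
       (qpoch_inf (x * s) q / (qpoch (x * s) q i * qpoch_inf x q)) *
       (qpoch s q M * qpoch (a / B) q M * qpoch x q (i - M) / (qpoch l q M * R M * R (i - M)) *
         x ^ M) *
       phi21 q a (b / s) B (x * s * Q ^ i)" if "M \<le> i" for M
      using that qpoch_inf_shift[OF x(1), of "i - M"] qpoch_inf_shift[OF xs, of i]
      by (simp add: g_def e_def Q_def[symmetric]) (simp add: mult_ac)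
    then have "(\<Sum>M\<le>i. g (M, i - M)) = (\<Sum>M\<le>i. K * B ^ i * qpoch l q i *
       (qpoch_inf (x * s) q / (qpoch (x * s) q i * qpoch_inf x q)) *
       (qpoch s q M * qpoch (a / B) q M * qpoch x q (i - M) / (qpoch l q M * R M * R (i - M)) *
         x ^ M) *
       phi21 q a (b / s) B (x * s * Q ^ i))"
      by (intro sum.cong) auto
    also have "\<dots> = erdelyi_term q a b B l s x 0 0 i"
      unfolding erdelyi_term_expand[OF x xs] sum_distrib_left[symmetric]
        sum_distrib_right[symmetric]
      by (simp add: K_def R_def Q_def phi21_def)
    finally show ?thesis .
  qed
  with 1 have res1: "(erdelyi_term q a b B l s x 0 0 has_sum S) UNIV"
    by (simp add: fun_eq_iff cong: has_sum_cong)
  have "((\<lambda>((M, r, m), k). T ((M, k), (r, m))) has_sum S) UNIV"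
    using T
    by (subst (asm) has_sum_reindex_bij_witness[of UNIV "\<lambda>((M, r, m), k). ((M, k), (r, m))"
         "\<lambda>((M, k), (r, m)). ((M, r, m), k)" UNIV "\<lambda>((M, r, m), k). T ((M, k), (r, m))" T S S]) auto
  then have "(h has_sum S) UNIV"
  proof (rule has_sum_prodD)
    fix Mrm :: "nat \<times> nat \<times> nat"
    obtain M r m where Mrm: "Mrm = (M, r, m)" by (metis prod_cases3)
    define C where "C = K * B ^ M * qpoch s q (M + r) * qpoch (a / B) q M / (R M * R r) *
      x ^ (M + r + m) * s ^ m * Q ^ (M * m) * f m"
    \<comment> \<open>The factor 1/(l)_M in \<open>e\<close> turns (l)_(M+k) into (l q^M)_k, and the
      powers of q attached to r and m turn B^k into (B q^(r+m))^k.\<close>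
    have "((\<lambda>k. qpoch (l * Q ^ M) q k / R k * (B * Q ^ (r + m)) ^ k) has_sum
           qpoch_inf (l * Q ^ M * (B * Q ^ (r + m))) q / qpoch_inf (B * Q ^ (r + m)) q) UNIV"
      unfolding R_def Q_def by (intro q_binomial_theorem norm_mult_q_power_less B)
    then have "((\<lambda>k. C * (qpoch (l * Q ^ M) q k / R k * (B * Q ^ (r + m)) ^ k)) has_sum
           C * (qpoch_inf (l * Q ^ M * (B * Q ^ (r + m))) q / qpoch_inf (B * Q ^ (r + m)) q)) UNIV"
      by (rule has_sum_cmult_right)
    moreover have "C * (qpoch (l * Q ^ M) q k / R k * (B * Q ^ (r + m)) ^ k) =
      T ((M, k), (r, m))" for k
      using nz(4)[of M]
      by (simp add: T_def C_def e_def qpoch_add[of s] qpoch_add[of l] Q_def[symmetric]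
               power_add power_mult_distrib add_mult_distrib add_mult_distrib2 mult_ac flip:
                 power_mult)
    moreover have "C * (qpoch_inf (l * Q ^ M * (B * Q ^ (r + m))) q / qpoch_inf (B * Q ^ (r + m))
      q) = h (M, r, m)"
    proof -
      have e: "l * Q ^ M * (B * Q ^ (r + m)) = B * l * Q ^ (M + r + m)"
        by (simp add: power_add mult_ac)
      show ?thesis
        unfolding e using qpoch_inf_shift[OF B(1), of "r + m"] qpoch_inf_shift[OF Bl, of
          "M + r + m"] nzi
        by (simp add: C_def h_def K_def f_def Q_def[symmetric] mult_ac)
    qed
    ultimately show "((\<lambda>k. (\<lambda>((M, r, m), k). T ((M, k), (r, m))) (Mrm, k)) has_sum h Mrm) UNIV"
      by (simp add: Mrm)
  qed
  \<comment> \<open>The partial sums M, M + r, M + r + m become the indices, so that the two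
    convolutions are nested finite sums with M innermost.\<close>
  then have "((\<lambda>(n, R, M). h (M, R - M, n - R)) has_sum S)
    (Sigma UNIV (\<lambda>n. Sigma {..n} (\<lambda>R. {..R})))"
    by (subst (asm) has_sum_reindex_bij_witness[of UNIV "\<lambda>(n, R, M). (M, R - M, n - R)"
      "\<lambda>(M, r, m). (M + r + m, M + r, M)"
          "Sigma UNIV (\<lambda>n. Sigma {..n} (\<lambda>R. {..R}))" "\<lambda>(n, R, M). h (M, R - M, n - R)" h S S]) auto
  then have 2: "((\<lambda>n. \<Sum>j\<le>n. \<Sum>M\<le>j. h (M, j - M, n - j)) has_sum S) UNIV"
    by (rule has_sum_SigmaD) (auto simp: sum.Sigma case_prod_unfold intro!: has_sum_finiteI)
  have "(\<Sum>j\<le>n. \<Sum>M\<le>j. h (M, j - M, n - j)) = qpoch a q n * qpoch b q n / (qpoch (B * l) q n * R n)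
    * x ^ n" for n
  proof -
    \<comment> \<open>For fixed m = n - j the sum over M is a q-Vandermonde convolution with
      parameters a/B and B q^m. Its value (a q^m)_j completes (a)_m to (a)_n, and B survives only in
      (B l)_n.\<close>
    have inner: "(\<Sum>M\<le>j. h (M, j - M, n - j)) = qpoch a q n / qpoch (B * l) q n * x ^ n *
        (qpoch (b / s) q (n - j) * s ^ (n - j) * qpoch s q j / (R (n - j) * R j))" if j:
          "j \<le> n" for j
    proof -
      define m where "m = n - j"
      have n: "n = m + j" using j by (simp add: m_def)
      have "(\<Sum>M\<le>j. h (M, j - M, m)) = (\<Sum>M\<le>j. qpoch s q j * qpoch a q m * qpoch (b / s) q m *
        s ^ m / (R m * qpoch (B * l) q n) * x ^ n *
         (qpoch (a / B) q M * (B * Q ^ m) ^ M * qpoch (B * Q ^ m) q (j - M) / (R M * R (j - M))))"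
      proof (rule sum.cong)
        fix M assume "M \<in> {..j}"
        then have M: "M + (j - M) = j" "j + m = n" by (auto simp: n)
        have B': "qpoch B q (j - M + m) = qpoch B q m * qpoch (B * Q ^ m) q (j - M)"
          by (subst add.commute) (simp add: qpoch_add Q_def)
        show "h (M, j - M, m) = qpoch s q j * qpoch a q m * qpoch (b / s) q m * s ^ m / (R m *
          qpoch (B * l) q n) * x ^ n *
         (qpoch (a / B) q M * (B * Q ^ m) ^ M * qpoch (B * Q ^ m) q (j - M) / (R M * R (j - M)))"
          unfolding h_def prod.case M B'
          using nz(3)[of m] by (simp add: Q_def[symmetric] power_mult_distrib mult_ac flip:
            power_mult)
      qed simp
      also have "\<dots> = qpoch s q j * qpoch a q m * qpoch (b / s) q m * s ^ m / (R m * qpoch (B * l)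
        q n) * x ^ n *
          (qpoch (a / B * (B * Q ^ m)) q j / R j)"
        unfolding R_def Q_def
        by (simp only: qpoch_convolution[OF qpoch_q_nonzero] flip: sum_distrib_left)
      also have "a / B * (B * Q ^ m) = a * Q ^ m"
        using B by simp
      finally show ?thesis
        by (simp add: m_def[symmetric] n qpoch_add[of a] Q_def[symmetric] mult_ac)
    qed
    have "(\<Sum>j\<le>n. \<Sum>M\<le>j. h (M, j - M, n - j)) = (\<Sum>j\<le>n. qpoch a q n / qpoch (B * l) q n * x ^ n *
        (qpoch (b / s) q (n - j) * s ^ (n - j) * qpoch s q j / (R (n - j) * R j)))"
      by (intro sum.cong) (auto simp: inner)
    also have "\<dots> = (\<Sum>k\<le>n. qpoch a q n / qpoch (B * l) q n * x ^ n *
        (qpoch (b / s) q k * s ^ k * qpoch s q (n - k) / (R k * R (n - k))))"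
      by (rule sum.reindex_bij_witness[of _ "\<lambda>k. n - k" "\<lambda>k. n - k"]) auto
    \<comment> \<open>The second convolution, with parameters b/s and s, eliminates s.\<close>
    also have "\<dots> = qpoch a q n / qpoch (B * l) q n * x ^ n * (qpoch (b / s * s) q n / R n)"
      unfolding R_def Q_def
      by (simp only: qpoch_convolution[OF qpoch_q_nonzero] flip: sum_distrib_left)
    finally show ?thesis
      using s by simp
  qed
  with 2 have "((\<lambda>n. qpoch a q n * qpoch b q n / (qpoch (B * l) q n * R n) * x ^ n) has_sum S) UNIV"
    by simp
  then have "S = phi21 q a b (B * l) x"
    by (simp add: phi21_def R_def Q_def infsumI)
  with res1 show ?thesis by simp
qed

text \<open>The value for P = p = 0 is free of \<open>s\<close>, so replacing s by s q^P leaves no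
  trace beyond (s)_P. This is why P and p enter the 2phi1 series only through their sum.\<close>

lemma erdelyi_has_sum:
  assumes x: "norm x < 1" "x \<noteq> 0" and xs: "norm (x * s) < 1" and s: "s \<noteq> 0"
    and B: "norm B < 1" "B \<noteq> 0" and l: "norm l < 1"
  shows "(erdelyi_term q a b B l s x P p has_sum
          qpoch s q P * qpoch (b / s) q p * phi21 q a (b * of_real q ^ (P + p)) (B * l) x) UNIV"
proof -
  have 1: "norm (x * (s * of_real q ^ P)) < 1"
    using norm_mult_q_power_less[OF xs, of P] by (simp add: mult_ac)
  have "erdelyi_term q a b B l s x P p = (\<lambda>i. qpoch s q P * qpoch (b / s) q p *
         erdelyi_term q a (b * of_real q ^ (P + p)) B l (s * of_real q ^ P) x 0 0 i)"
    by (rule ext) (rule erdelyi_term_shift[OF xs])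
  then show ?thesis
    using s q_pos by (auto intro!: has_sum_cmult_right erdelyi_has_sum_0 x 1 B l)
qed

text \<open>Provides geometric decay in i, uniform in P and p, for the summability of the series
  over all nodes and indices. It is read off from the reversed form, since in the defining form the
  factorials with parameter q^(-i) are unbounded.\<close>

lemma erdelyi_term_bounded:
  assumes x: "norm x < 1" "x \<noteq> 0" and xs: "norm (x * s) < 1"
  obtains g where "bounded (range (\<lambda>(P, p, i). g P p i))"
    "\<And>P p i. erdelyi_term q a b B l s x P p i = B ^ i * g P p i"
proof
  define Q where "Q = complex_of_real q"
  have Q1: "norm Q \<le> 1" using q_pos q_less by (simp add: Q_def)
  \<comment> \<open>The indicator makes the finite sum a sum over all M, as
    \<open>bounded_range_infsum\<close> expects; it discards the terms M > i, where
    \<open>i - M\<close> is truncated to 0.\<close>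
  define F where "F P i M = (if M \<le> i then 1 else 0) * (qpoch s q (P + M) * qpoch (a / B) q M *
    qpoch x q (i - M) *
        inverse (qpoch l q M) * inverse (qpoch Q q M) * inverse (qpoch Q q (i - M)))" for P i M ::
          nat
  define G where "G P p i m = qpoch a q m * qpoch (b / s) q (m + p) * inverse (qpoch B q m) *
    inverse (qpoch Q q m) *
        Q ^ ((i + P) * m)" for P p i m :: nat
  define g where "g P p i = qpoch_inf B q / qpoch_inf (B * l) q * qpoch l q i *
     (qpoch_inf (x * s) q / qpoch_inf x q) * inverse (qpoch (x * s) q (i + P)) *
     (\<Sum>\<^sub>\<infinity>M. F P i M * x ^ M) * (\<Sum>\<^sub>\<infinity>m. G P p i m * (x * s) ^ m)" for P p i
  show "bounded (range (\<lambda>(P, p, i). g P p i))"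
  proof -
    have "bounded (range (\<lambda>y::(nat \<times> nat \<times> nat) \<times> nat. if snd y \<le> snd (snd (fst y))
      then 1 else 0 :: complex))"
      by (auto simp: bounded_iff intro!: exI[of _ 1])
    then have "bounded (range (\<lambda>(y::(nat \<times> nat \<times> nat), M). F (fst y) (snd (snd y)) M))"
      unfolding F_def case_prod_unfold by (intro bounded_range_intros)
    then have 1: "bounded (range (\<lambda>y::(nat \<times> nat \<times> nat). \<Sum>\<^sub>\<infinity>M. F (fst y) (snd (snd y)) M * x ^ M))"
      by (rule bounded_range_infsum) (rule summable_on_geometric[OF x(1)])
    have "bounded (range (\<lambda>(y::(nat \<times> nat \<times> nat), m). G (fst y) (fst (snd y)) (snd (snd y)) m))"
      unfolding G_def case_prod_unfold by (intro bounded_range_intros Q1)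
    then have 2: "bounded (range (\<lambda>y::(nat \<times> nat \<times> nat). \<Sum>\<^sub>\<infinity>m. G (fst y) (fst (snd y))
      (snd (snd y)) m * (x * s) ^ m))"
      by (rule bounded_range_infsum) (rule summable_on_geometric[OF xs])
    show ?thesis
      unfolding g_def case_prod_unfold by (intro bounded_range_intros 1 2)
  qed
  fix P p i
  have F: "(\<Sum>\<^sub>\<infinity>M. F P i M * x ^ M) = (\<Sum>M\<le>i. qpoch s q (P + M) * qpoch (a / B) q M *
    qpoch x q (i - M) /
        (qpoch l q M * qpoch Q q M * qpoch Q q (i - M)) * x ^ M)"
  proof -
    have "(\<Sum>\<^sub>\<infinity>M. F P i M * x ^ M) = (\<Sum>\<^sub>\<infinity>M\<in>{..i}. F P i M * x ^ M)"
      by (rule infsum_cong_neutral) (auto simp: F_def)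
    then show ?thesis
      by (simp add: F_def divide_inverse mult_ac)
  qed
  have G: "(\<Sum>\<^sub>\<infinity>m. G P p i m * (x * s) ^ m) = (\<Sum>\<^sub>\<infinity>m. qpoch a q m * qpoch (b / s) q (m + p) /
    (qpoch B q m * qpoch Q q m) *
        (x * s * Q ^ (i + P)) ^ m)"
    by (rule infsum_cong) (simp add: G_def divide_inverse power_mult_distrib mult_ac flip:
      power_mult)
  show "erdelyi_term q a b B l s x P p i = B ^ i * g P p i"
    unfolding erdelyi_term_expand[OF x xs] g_def F G Q_def by (simp add: divide_inverse mult_ac)
qed

subsection \<open>The q-Dirichlet measure and Saran's function\<close>

lemma qpow_add: "qpow q (a + b) = qpow q a * qpow q b"
  by (rule powr_add)

lemma qpow_diff: "qpow q (a - b) = qpow q a / qpow q b"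
  by (rule powr_diff)

lemma norm_qpow_less_1: "Re a > 0 \<Longrightarrow> norm (qpow q a) < 1"
  using q_pos q_less by (simp add: norm_powr_real_powr powr01_less_one)

text \<open>The powers of 1 - q in the three q-gamma factors combine to (1 - q)^(-1), cancelled by
  the 1 - q of the q-integral, whose q^i raises the exponent \<alpha> - 1 to \<alpha>. The result is
  the weight in \<open>erdelyi_term\<close> with B = q^\<alpha> and l = q^\<beta>.\<close>

lemma qdirichlet_power:
  assumes \<alpha>: "Re \<alpha> > 0" and \<beta>: "Re \<beta> > 0"
  shows "of_real ((1 - q) * q ^ i) * qdirichlet q \<alpha> \<beta> (q ^ i) =
     qpoch_inf (qpow q \<alpha>) q / qpoch_inf (qpow q \<alpha> * qpow q \<beta>) q * qpow q \<alpha> ^ i *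
     qpoch (qpow q \<beta>) q i / qpoch (of_real q) q i"
proof -
  define A B Q where "A = qpow q \<alpha>" and "B = qpow q \<beta>" and "Q = complex_of_real q"
  define r where "r = complex_of_real (1 - q)"
  have Q: "norm Q < 1" "Q \<noteq> 0" using q_pos q_less by (auto simp: Q_def)
  have B: "norm B < 1" and A: "norm A < 1"
    using \<alpha> \<beta> by (auto simp: A_def B_def norm_qpow_less_1)
  have r0: "r \<noteq> 0" using q_less by (simp add: r_def)
  have nz: "qpoch_inf Q q \<noteq> 0" "qpoch_inf A q \<noteq> 0" "qpoch_inf B q \<noteq> 0"
    using A B Q by (simp_all add: qpoch_inf_nonzero')
  have r: "r powr (1 - (\<alpha> + \<beta>)) * r = r powr (1 - \<alpha>) * r powr (1 - \<beta>)"
    using r0 by (simp add: powr_diff powr_add field_simps)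
  have g: "r * (qGamma q (\<alpha> + \<beta>) / (qGamma q \<alpha> * qGamma q \<beta>)) =
      qpoch_inf A q * qpoch_inf B q / (qpoch_inf (A * B) q * qpoch_inf Q q)"
  proof -
    have "r * (qGamma q (\<alpha> + \<beta>) / (qGamma q \<alpha> * qGamma q \<beta>)) =
      (qpoch_inf Q q / qpoch_inf (A * B) q) * (r powr (1 - (\<alpha> + \<beta>)) * r) /
      (qpoch_inf Q q / qpoch_inf A q * (qpoch_inf Q q / qpoch_inf B q) * (r powr (1 - \<alpha>) *
        r powr (1 - \<beta>)))"
      unfolding qGamma_def qpow_add A_def B_def Q_def r_def by (simp add: mult_ac)
    also have "\<dots> = (qpoch_inf Q q / qpoch_inf (A * B) q) /
      (qpoch_inf Q q / qpoch_inf A q * (qpoch_inf Q q / qpoch_inf B q))"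
      unfolding r using r0 by simp
    also have "\<dots> = qpoch_inf A q * qpoch_inf B q / (qpoch_inf (A * B) q * qpoch_inf Q q)"
      using nz by (simp add: field_simps)
    finally show ?thesis .
  qed
  have p: "Q ^ i * of_real (q ^ i) powr (\<alpha> - 1) = A ^ i"
  proof -
    have "complex_of_real (q ^ i) powr (\<alpha> - 1) = qpow q (\<alpha> - 1) ^ i"
      using q_pos
      by (simp add: powr_def Ln_of_real ln_realpow exp_of_nat_mult[symmetric] mult_ac del:
        of_real_power)
    also have "\<dots> = A ^ i / Q ^ i"
      using Q by (simp add: qpow_diff A_def Q_def power_divide)
    finally have "complex_of_real (q ^ i) powr (\<alpha> - 1) = A ^ i / Q ^ i" .
    then show ?thesis using Q by simp
  qed
  have q1: "qpoch_inf (of_real (q ^ i * q)) q = qpoch_inf Q q / qpoch Q q i"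
    using qpoch_inf_shift[OF Q(1), of i] by (simp add: Q_def mult.commute)
  have q2: "qpoch_inf (of_real (q ^ i) * B) q = qpoch_inf B q / qpoch B q i"
    using qpoch_inf_shift[OF B, of i] by (simp add: mult.commute)
  have "of_real ((1 - q) * q ^ i) * qdirichlet q \<alpha> \<beta> (q ^ i) =
     (r * (qGamma q (\<alpha> + \<beta>) / (qGamma q \<alpha> * qGamma q \<beta>))) * (Q ^ i * of_real (q ^ i) powr (\<alpha> - 1)) *
     (qpoch_inf (of_real (q ^ i * q)) q / qpoch_inf (of_real (q ^ i) * B) q)"
    by (simp add: qdirichlet_def r_def Q_def B_def)
  also have "\<dots> = qpoch_inf A q / qpoch_inf (A * B) q * A ^ i * qpoch B q i / qpoch Q q i"
    unfolding g p q1 q2 using nz by (simp add: mult_ac)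
  finally show ?thesis
    by (simp add: A_def B_def Q_def)
qed

text \<open>The n-th moment of the q-Dirichlet measure, q^(k n) being t^n at t = q^k. It merely
  changes the argument of the q-binomial series from A to A q^n.\<close>

lemma q_beta_has_sum:
  assumes A: "norm A < 1" and B: "norm B < 1"
  shows "((\<lambda>k. qpoch_inf A q / qpoch_inf (A * B) q * A ^ k * qpoch B q k / qpoch (of_real q) q k *
    of_real q ^ (k * n)) has_sum
          qpoch A q n / qpoch (A * B) q n) UNIV"
proof -
  define Q where "Q = complex_of_real q"
  define C where "C = qpoch_inf A q / qpoch_inf (A * B) q"
  have AB: "norm (A * B) < 1"
    using norm_mult_less[OF A B] by simp
  have "((\<lambda>k. C * (qpoch B q k / qpoch Q q k * (A * Q ^ n) ^ k)) has_sum
          C * (qpoch_inf (B * (A * Q ^ n)) q / qpoch_inf (A * Q ^ n) q)) UNIV"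
    unfolding Q_def
    by (intro has_sum_cmult_right q_binomial_theorem norm_mult_q_power_less A)
  also have "B * (A * Q ^ n) = A * B * Q ^ n"
    by simp
  also have "C * (qpoch_inf (A * B * Q ^ n) q / qpoch_inf (A * Q ^ n) q) = qpoch A q n /
    qpoch (A * B) q n"
    using qpoch_inf_shift[OF A, of n] qpoch_inf_shift[OF AB, of n]
      qpoch_inf_nonzero'[OF A] qpoch_inf_nonzero'[OF AB]
    by (simp add: C_def Q_def)
  finally show ?thesis
    by (simp add: C_def Q_def power_mult_distrib mult_ac flip: power_mult)
qed

text \<open>The indices m and n interact only through p, so for fixed p the double sum is a product.
  This isolates the powers of z, by which the two sides are compared later.\<close>

lemma PhiK_has_sum:
  assumes x: "norm x < 1" and y: "norm y < 1" and z: "norm z < 1"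
  shows "((\<lambda>p. z ^ p / (qpoch (qpow q \<gamma>\<^sub>3) q p * qpoch (of_real q) q p) *
     (\<Sum>\<^sub>\<infinity>m. qpoch (qpow q \<alpha>\<^sub>1) q m * qpoch (qpow q \<beta>\<^sub>1) q (m + p) / (qpoch (qpow q \<gamma>\<^sub>1) q m *
       qpoch (of_real q) q m) * x ^ m) *
     (\<Sum>\<^sub>\<infinity>n. qpoch (qpow q \<beta>\<^sub>2) q n * qpoch (qpow q \<alpha>\<^sub>2) q (n + p) / (qpoch (qpow q \<gamma>\<^sub>2) q n *
       qpoch (of_real q) q n) * y ^ n))
     has_sum PhiK \<alpha>\<^sub>1 \<alpha>\<^sub>2 \<beta>\<^sub>1 \<beta>\<^sub>2 \<gamma>\<^sub>1 \<gamma>\<^sub>2 \<gamma>\<^sub>3 q x y z) UNIV"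
proof -
  define Q where "Q = complex_of_real q"
  define u where "u p m = qpoch (qpow q \<alpha>\<^sub>1) q m * qpoch (qpow q \<beta>\<^sub>1) q (m + p) /
    (qpoch (qpow q \<gamma>\<^sub>1) q m * qpoch Q q m) * x ^ m" for p m
  define v where "v p n = qpoch (qpow q \<beta>\<^sub>2) q n * qpoch (qpow q \<alpha>\<^sub>2) q (n + p) /
    (qpoch (qpow q \<gamma>\<^sub>2) q n * qpoch Q q n) * y ^ n" for p n
  define d where "d p = z ^ p / (qpoch (qpow q \<gamma>\<^sub>3) q p * qpoch Q q p)" for p
  define t where "t = (\<lambda>(m, n, p). d p * (u p m * v p n))"
  have "t summable_on UNIV"
  proof -
    define c where "c = (\<lambda>y::nat \<times> nat \<times> nat. qpoch (qpow q \<alpha>\<^sub>1) q (fst y) * qpoch (qpow q \<beta>\<^sub>1)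
      q (fst y + snd (snd y)) *
      inverse (qpoch (qpow q \<gamma>\<^sub>1) q (fst y)) * inverse (qpoch Q q (fst y)) *
      qpoch (qpow q \<beta>\<^sub>2) q (fst (snd y)) * qpoch (qpow q \<alpha>\<^sub>2) q (fst (snd y) + snd (snd y)) *
      inverse (qpoch (qpow q \<gamma>\<^sub>2) q (fst (snd y))) * inverse (qpoch Q q (fst (snd y))) *
      inverse (qpoch (qpow q \<gamma>\<^sub>3) q (snd (snd y))) * inverse (qpoch Q q (snd (snd y))))"
    have "bounded (range c)"
      unfolding c_def by (intro bounded_range_intros)
    then have "(\<lambda>y'. c y' * (case y' of (m, n, p) \<Rightarrow> x ^ m * (y ^ n * z ^ p))) summable_on UNIV"
      by (rule summable_on_bounded_mult[OF _ summable_on_power3[OF x y z]])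
    also have "(\<lambda>y'. c y' * (case y' of (m, n, p) \<Rightarrow> x ^ m * (y ^ n * z ^ p))) = t"
      by (auto simp: fun_eq_iff c_def t_def u_def v_def d_def divide_inverse mult_ac)
    finally show ?thesis .
  qed
  moreover have "infsum t UNIV = PhiK \<alpha>\<^sub>1 \<alpha>\<^sub>2 \<beta>\<^sub>1 \<beta>\<^sub>2 \<gamma>\<^sub>1 \<gamma>\<^sub>2 \<gamma>\<^sub>3 q x y z"
    unfolding PhiK_def by (rule infsum_cong) (auto simp:
      t_def u_def v_def d_def Q_def divide_inverse mult_ac)
  ultimately have "(t has_sum PhiK \<alpha>\<^sub>1 \<alpha>\<^sub>2 \<beta>\<^sub>1 \<beta>\<^sub>2 \<gamma>\<^sub>1 \<gamma>\<^sub>2 \<gamma>\<^sub>3 q x y z) UNIV"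
    by (simp add: has_sum_iff)
  then have "((\<lambda>(p, m, n). t (m, n, p)) has_sum PhiK \<alpha>\<^sub>1 \<alpha>\<^sub>2 \<beta>\<^sub>1 \<beta>\<^sub>2 \<gamma>\<^sub>1 \<gamma>\<^sub>2 \<gamma>\<^sub>3 q x y z) UNIV"
    by (subst (asm) has_sum_reindex_bij_witness[of UNIV "\<lambda>(p, m, n). (m, n, p)"
      "\<lambda>(m, n, p). (p, m, n)" UNIV
          "\<lambda>(p, m, n). t (m, n, p)" t _ "PhiK \<alpha>\<^sub>1 \<alpha>\<^sub>2 \<beta>\<^sub>1 \<beta>\<^sub>2 \<gamma>\<^sub>1 \<gamma>\<^sub>2 \<gamma>\<^sub>3 q x y z"]) auto
  then have "((\<lambda>p. d p * (infsum (u p) UNIV * infsum (v p) UNIV)) has_sum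
    PhiK \<alpha>\<^sub>1 \<alpha>\<^sub>2 \<beta>\<^sub>1 \<beta>\<^sub>2 \<gamma>\<^sub>1 \<gamma>\<^sub>2 \<gamma>\<^sub>3 q x y z) UNIV"
  proof (rule has_sum_prodD)
    fix p
    have "u p summable_on UNIV"
      unfolding u_def divide_inverse inverse_mult_distrib
      by (intro summable_on_bounded_mult summable_on_geometric x bounded_range_intros)
    moreover have "v p summable_on UNIV"
      unfolding v_def divide_inverse inverse_mult_distrib
      by (intro summable_on_bounded_mult summable_on_geometric y bounded_range_intros)
    ultimately have "((\<lambda>(m, n). u p m * v p n) has_sum infsum (u p) UNIV * infsum (v p) UNIV)
      (UNIV \<times> UNIV)"
      by (intro has_sum_mult_prod) auto
    from has_sum_cmult_right[OF this, of "d p"]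
    show "((\<lambda>mn. (\<lambda>(p, m, n). t (m, n, p)) (p, mn)) has_sum d p * (infsum (u p) UNIV *
      infsum (v p) UNIV)) UNIV"
      by (simp add: t_def case_prod_unfold)
  qed
  then show ?thesis
    unfolding u_def v_def d_def Q_def by (simp add: mult.assoc)
qed

text \<open>For fixed p the sums over m and n decouple, and q^(-i), q^(-j) leave finitely many
  nonzero terms. The two factors are the M-sums of the \<open>erdelyi_term\<close> for u and of the
  one for v.\<close>

lemma phi3_coeff_factor:
  "phi3_coeff b' b'' c\<^sub>1 (inverse (of_real q ^ i)) c\<^sub>1' (inverse (of_real q ^ j))
    h\<^sub>1 h\<^sub>2 h\<^sub>1' h\<^sub>2' h\<^sub>1'' h\<^sub>2'' h\<^sub>3'' q (of_real q) (of_real q) p =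
   1 / (qpoch h\<^sub>1'' q p * qpoch h\<^sub>2'' q p * qpoch h\<^sub>3'' q p * qpoch (of_real q) q p) *
   ((\<Sum>\<^sub>\<infinity>m. qpoch b'' q (p + m) * (qpoch c\<^sub>1 q m * qpoch (inverse (of_real q ^ i)) q m /
     (qpoch h\<^sub>1 q m * qpoch h\<^sub>2 q m)) *
        (of_real q ^ m / qpoch (of_real q) q m)) *
    (\<Sum>\<^sub>\<infinity>n. qpoch b' q (p + n) * (qpoch c\<^sub>1' q n * qpoch (inverse (of_real q ^ j)) q n /
      (qpoch h\<^sub>1' q n * qpoch h\<^sub>2' q n)) *
        (of_real q ^ n / qpoch (of_real q) q n)))"
proof -
  define u where "u m = qpoch b'' q (p + m) * (qpoch c\<^sub>1 q m * qpoch (inverse (of_real q ^ i))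
    q m / (qpoch h\<^sub>1 q m * qpoch h\<^sub>2 q m)) *
        (of_real q ^ m / qpoch (of_real q) q m)" for m
  define v where "v n = qpoch b' q (p + n) * (qpoch c\<^sub>1' q n * qpoch (inverse (of_real q ^ j))
    q n / (qpoch h\<^sub>1' q n * qpoch h\<^sub>2' q n)) *
        (of_real q ^ n / qpoch (of_real q) q n)" for n
  have "finite {m \<in> UNIV. u m \<noteq> 0}"
    by (rule finite_subset[of _ "{..i}"])
       (auto simp: u_def qpoch_inverse_power_eq_0 intro: leI)
  then have "u summable_on UNIV"
    by (rule finite_nonzero_values_imp_summable_on)
  moreover have "finite {m \<in> UNIV. v m \<noteq> 0}"
    by (rule finite_subset[of _ "{..j}"])
       (auto simp: v_def qpoch_inverse_power_eq_0 intro: leI)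
  then have "v summable_on UNIV"
    by (rule finite_nonzero_values_imp_summable_on)
  ultimately have "((\<lambda>(m, n). u m * v n) has_sum infsum u UNIV * infsum v UNIV) (UNIV \<times> UNIV)"
    by (intro has_sum_mult_prod) auto
  then have "(\<Sum>\<^sub>\<infinity>(m, n). u m * v n) = infsum u UNIV * infsum v UNIV"
    by (simp add: infsumI)
  moreover have "(\<Sum>\<^sub>\<infinity>(m, n). u m * v n) = (\<Sum>\<^sub>\<infinity>(m, n)\<in>UNIV.
        qpoch b' q (n + p) * qpoch b'' q (p + m) *
        (qpoch c\<^sub>1 q m * qpoch (inverse (of_real q ^ i)) q m / (qpoch h\<^sub>1 q m * qpoch h\<^sub>2 q m)) *
        (qpoch c\<^sub>1' q n * qpoch (inverse (of_real q ^ j)) q n / (qpoch h\<^sub>1' q n * qpoch h\<^sub>2' q n)) *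
        (of_real q ^ m * of_real q ^ n / (qpoch (of_real q) q m * qpoch (of_real q) q n)))"
    by (rule infsum_cong) (auto simp: u_def v_def add.commute[of p] divide_inverse mult_ac)
  ultimately show ?thesis
    unfolding phi3_coeff_def u_def v_def by simp
qed

end

section \<open>The integral formula for Saran's function\<close>

theorem theorem4p8:
  fixes q :: real
    and \<alpha>\<^sub>1 \<alpha>\<^sub>2 \<beta>\<^sub>1 \<beta>\<^sub>2 \<gamma>\<^sub>3 \<eta>\<^sub>1 \<eta>\<^sub>2 \<mu>\<^sub>2 lam\<^sub>1 lam\<^sub>2 lam\<^sub>3 x y z :: complex
  assumes "0 < q" and "q < 1"
    and "Re (\<alpha>\<^sub>1 + \<eta>\<^sub>1) > Re lam\<^sub>1" and "Re lam\<^sub>1 > 0"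
    and "Re (\<beta>\<^sub>2 + \<mu>\<^sub>2) > Re lam\<^sub>2" and "Re lam\<^sub>2 > 0"
    and "Re \<gamma>\<^sub>3 > Re \<beta>\<^sub>1" and "Re \<beta>\<^sub>1 > 0"
    and "x \<noteq> 0" and "y \<noteq> 0"
    and "norm x < 1" and "norm y < 1" and "norm z < 1"
    and "norm (x * qpow q lam\<^sub>3) < 1"
    and "norm (y * qpow q \<eta>\<^sub>2) < 1"
    and "norm (z * qpow q (\<alpha>\<^sub>2 - \<eta>\<^sub>2)) < 1"
    and "\<And>p. qpoch (qpow q lam\<^sub>3) q p \<noteq> 0"
    and "\<And>p. qpoch (qpow q (\<beta>\<^sub>1 - lam\<^sub>3)) q p \<noteq> 0"
  shows
    "PhiK \<alpha>\<^sub>1 \<alpha>\<^sub>2 \<beta>\<^sub>1 \<beta>\<^sub>2 (\<alpha>\<^sub>1 + \<eta>\<^sub>1) (\<beta>\<^sub>2 + \<mu>\<^sub>2) \<gamma>\<^sub>3 q x y z =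
     qintegral3 q (\<lambda>u v w.
       qpoch_inf (of_real u * x * qpow q lam\<^sub>3) q * qpoch_inf (of_real v * y * qpow q \<eta>\<^sub>2) q /
         (qpoch_inf (of_real u * x) q * qpoch_inf (of_real v * y) q) *
       qshift_series q
         (phi3_coeff
            (qpow q \<eta>\<^sub>2) (qpow q lam\<^sub>3)
            (qpow q (lam\<^sub>1 - \<eta>\<^sub>1)) (inverse (of_real u))
            (qpow q (lam\<^sub>2 - \<mu>\<^sub>2)) (inverse (of_real v))
            (qpow q lam\<^sub>1) (of_real q / (of_real u * x))
            (qpow q lam\<^sub>2) (of_real q / (of_real v * y))
            (of_real u * x * qpow q lam\<^sub>3) (of_real v * y * qpow q \<eta>\<^sub>2) (qpow q lam\<^sub>3)
            q (of_real q) (of_real q))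
         (of_real w * z * qpow q (\<alpha>\<^sub>2 - \<eta>\<^sub>2))
         (\<lambda>x' y'. PhiK \<alpha>\<^sub>1 (\<alpha>\<^sub>2 - \<eta>\<^sub>2) (\<beta>\<^sub>1 - lam\<^sub>3) \<beta>\<^sub>2
            (\<alpha>\<^sub>1 - lam\<^sub>1 + \<eta>\<^sub>1) (\<beta>\<^sub>2 - lam\<^sub>2 + \<mu>\<^sub>2) (\<beta>\<^sub>1 - lam\<^sub>3) q
            (of_real u * x' * qpow q lam\<^sub>3) (of_real v * y' * qpow q \<eta>\<^sub>2) (of_real w * z))
         x y *
       qdirichlet q (\<alpha>\<^sub>1 - lam\<^sub>1 + \<eta>\<^sub>1) lam\<^sub>1 u *
       qdirichlet q (\<beta>\<^sub>2 - lam\<^sub>2 + \<mu>\<^sub>2) lam\<^sub>2 v *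
       qdirichlet q \<beta>\<^sub>1 (\<gamma>\<^sub>3 - \<beta>\<^sub>1) w)"
proof -
  note q = assms(1,2)
  define Q where "Q = complex_of_real q"
  define a1 where "a1 = qpow q \<alpha>\<^sub>1"
  define a2 where "a2 = qpow q \<alpha>\<^sub>2"
  define b1 where "b1 = qpow q \<beta>\<^sub>1"
  define b2 where "b2 = qpow q \<beta>\<^sub>2"
  define s where "s = qpow q lam\<^sub>3"
  define e where "e = qpow q \<eta>\<^sub>2"
  define B1 where "B1 = qpow q (\<alpha>\<^sub>1 - lam\<^sub>1 + \<eta>\<^sub>1)"
  define B2 where "B2 = qpow q (\<beta>\<^sub>2 - lam\<^sub>2 + \<mu>\<^sub>2)"
  define l1 where "l1 = qpow q lam\<^sub>1"
  define l2 where "l2 = qpow q lam\<^sub>2"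
  define l3 where "l3 = qpow q (\<gamma>\<^sub>3 - \<beta>\<^sub>1)"
  define t where "t = qpow q (\<alpha>\<^sub>2 - \<eta>\<^sub>2)"
  define R where "R = qpoch Q q"
  have Q1: "norm Q \<le> 1" using q by (simp add: Q_def)
  have n: "norm B1 < 1" "norm B2 < 1" "norm l1 < 1" "norm l2 < 1" "norm b1 < 1" "norm l3 < 1"
    using assms(3-8) by (auto simp: B1_def B2_def l1_def l2_def l3_def b1_def intro!:
      norm_qpow_less_1[OF q])
  have nz: "B1 \<noteq> 0" "B2 \<noteq> 0" "s \<noteq> 0" "e \<noteq> 0" "l1 \<noteq> 0" "l2 \<noteq> 0" "b1 \<noteq> 0"
    using q by (auto simp: B1_def B2_def s_def e_def l1_def l2_def b1_def)
  have x: "norm x < 1" "x \<noteq> 0" and y: "norm y < 1" "y \<noteq> 0" and z: "norm z < 1"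
    and xs: "norm (x * s) < 1" and ye: "norm (y * e) < 1" and zt: "norm (z * t) < 1"
    using assms by (simp_all add: s_def e_def t_def)
  \<comment> \<open>For instance lam1 - eta1 = alpha1 - (alpha1 - lam1 + eta1), so the phi3
    parameter is the quotient a/B of \<open>erdelyi_term\<close>.\<close>
  have par: "qpow q (lam\<^sub>1 - \<eta>\<^sub>1) = a1 / B1" "qpow q (lam\<^sub>2 - \<mu>\<^sub>2) = b2 / B2"
    "qpow q (\<alpha>\<^sub>1 + \<eta>\<^sub>1) = B1 * l1" "qpow q (\<beta>\<^sub>2 + \<mu>\<^sub>2) = B2 * l2" "qpow q \<gamma>\<^sub>3 = b1 * l3"
    "qpow q (\<beta>\<^sub>1 - lam\<^sub>3) = b1 / s" "t = a2 / e"
    using q by (simp_all add: a1_def a2_def b1_def b2_def s_def e_def B1_def B2_def l1_def l2_def l3_def t_def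
                  algebra_simps flip: powr_diff powr_add)
  \<comment> \<open>Needed to cancel (s)_P and (b1/s)_p, produced by the u-integral, against the
    denominators in \<open>D\<close>; at a zero the convention x / 0 = 0 would spoil this.\<close>
  have s0: "qpoch s q P \<noteq> 0" and bs0: "qpoch (b1 / s) q P \<noteq> 0" for P
    using assms(17)[of P] assms(18)[of P] unfolding par s_def[symmetric] by auto

  define F where "F = erdelyi_term q a1 b1 B1 l1 s x"
  \<comment> \<open>In the inner function the parameter of (.)_(n+p) is a2/e, so here
    \<open>b2\<close>, \<open>a2\<close> and \<open>e\<close> stand for a, b and s.\<close>
  define G where "G = erdelyi_term q b2 a2 B2 l2 e y"
  define H where "H k = qpoch_inf b1 q / qpoch_inf (b1 * l3) q * b1 ^ k * qpoch l3 q k / R k" for k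
  \<comment> \<open>The part free of i, j, k: (s)_P is the third lower parameter of phi3, (b1/s)_p
    that of the inner function.\<close>
  define D where "D P p = (z * t) ^ P * z ^ p / (qpoch s q P * R P * (qpoch (b1 / s) q p *
    R p))" for P p
  \<comment> \<open>The factor \<open>Q ^ (k * (P + p))\<close> is w^P from the operator argument
    times w^p from the inner function, at w = q^k.\<close>
  define W where "W = (\<lambda>((i, j, k), (P, p)). F P p i * G P p j * (H k * Q ^ (k * (P + p))) * D P p)"

  have "W summable_on UNIV"
  proof -
    obtain f where f: "bounded (range (\<lambda>(P, p, i). f P p i))" "\<And>P p i. F P p i = B1 ^ i * f P p i"
      using erdelyi_term_bounded[OF q x xs, of a1 b1 B1 l1] unfolding F_def by blast
    obtain g where g: "bounded (range (\<lambda>(P, p, i). g P p i))" "\<And>P p i. G P p i = B2 ^ i * g P p i"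
      using erdelyi_term_bounded[OF q y ye, of b2 a2 B2 l2] unfolding G_def by blast
    define c where "c = (\<lambda>w::(nat \<times> nat \<times> nat) \<times> (nat \<times> nat).
        f (fst (snd w)) (snd (snd w)) (fst (fst w)) * g (fst (snd w)) (snd (snd w))
          (fst (snd (fst w))) *
        (qpoch_inf b1 q / qpoch_inf (b1 * l3) q * qpoch l3 q (snd (snd (fst w))) *
          inverse (qpoch Q q (snd (snd (fst w)))) *
        Q ^ (snd (snd (fst w)) * (fst (snd w) + snd (snd w)))) *
        (inverse (qpoch s q (fst (snd w))) * inverse (qpoch Q q (fst (snd w))) *
        inverse (qpoch (b1 / s) q (snd (snd w))) * inverse (qpoch Q q (snd (snd w)))))"
    define w where "w = (\<lambda>((i::nat, j::nat, k::nat), (P::nat, p::nat)). (B1 ^ i * (B2 ^ j *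
      b1 ^ k)) * ((z * t) ^ P * z ^ p))"
    have "bounded (range c)"
    proof -
      have f': "bounded (range (\<lambda>w::(nat \<times> nat \<times> nat) \<times> (nat \<times> nat). f (fst (snd w)) (snd (snd w))
        (fst (fst w))))"
        using bounded_range_comp[OF f(1), of "\<lambda>w::(nat \<times> nat \<times> nat)
          \<times> (nat \<times> nat). (fst (snd w), snd (snd w), fst (fst w))"] by simp
      have g': "bounded (range (\<lambda>w::(nat \<times> nat \<times> nat) \<times> (nat \<times> nat). g (fst (snd w)) (snd (snd w))
        (fst (snd (fst w)))))"
        using bounded_range_comp[OF g(1), of "\<lambda>w::(nat \<times> nat \<times> nat)
          \<times> (nat \<times> nat). (fst (snd w), snd (snd w), fst (snd (fst w)))"] by simp
      show ?thesis
        unfolding c_def by (intro bounded_range_intros[OF q] f' g' Q1)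
    qed
    moreover have "w summable_on UNIV"
    proof -
      have "(\<lambda>(P, p). (z * t) ^ P * z ^ p) summable_on UNIV \<times> UNIV"
        by (intro summable_on_mult_prod summable_on_geometric z zt)
      from summable_on_mult_prod[OF summable_on_power3[OF n(1,2,5)] this]
      show ?thesis
        by (simp add: w_def case_prod_unfold)
    qed
    ultimately have "(\<lambda>v. c v * w v) summable_on UNIV"
      by (rule summable_on_bounded_mult)
    also have "(\<lambda>v. c v * w v) = W"
      by (auto simp: fun_eq_iff c_def w_def W_def f(2) g(2)
        H_def D_def R_def divide_inverse mult_ac)
    finally show ?thesis .
  qed
  define S where "S = infsum W UNIV"
  have WS: "(W has_sum S) UNIV"
    using \<open>W summable_on UNIV\<close> by (simp add: S_def)

  \<comment> \<open>Summation over the integration nodes first\<close>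
  define T where "T N = z ^ N / (qpoch (b1 * l3) q N * R N) *
     (qpoch b1 q N * phi21 q a1 (b1 * Q ^ N) (B1 * l1) x) *
     (qpoch a2 q N * phi21 q b2 (a2 * Q ^ N) (B2 * l2) y)" for N
  have "((\<lambda>((P, p), (i, j, k)). W ((i, j, k), (P, p))) has_sum S) UNIV"
    using WS
    by (subst (asm) has_sum_reindex_bij_witness[of UNIV "\<lambda>(a, b). (b, a)" "\<lambda>(a, b). (b, a)" UNIV
         "\<lambda>((P, p), (i, j, k)). W ((i, j, k), (P, p))" W S S]) auto
  then have "((\<lambda>(P, p). D P p * ((qpoch s q P * qpoch (b1 / s) q p * phi21 q a1 (b1 * Q ^ (P + p))
    (B1 * l1) x) *
       ((qpoch e q P * qpoch (a2 / e) q p * phi21 q b2 (a2 * Q ^ (P + p)) (B2 * l2) y) *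
        (qpoch b1 q (P + p) / qpoch (b1 * l3) q (P + p))))) has_sum S) UNIV"
  proof (rule has_sum_prodD)
    fix Pp :: "nat \<times> nat"
    obtain P p where Pp: "Pp = (P, p)" by force
    have "((\<lambda>(i, jk). F P p i * (case jk of (j, k) \<Rightarrow> G P p j * (H k * Q ^ (k * (P + p))))) has_sum
       ((qpoch s q P * qpoch (b1 / s) q p * phi21 q a1 (b1 * Q ^ (P + p)) (B1 * l1) x) *
       ((qpoch e q P * qpoch (a2 / e) q p * phi21 q b2 (a2 * Q ^ (P + p)) (B2 * l2) y) *
        (qpoch b1 q (P + p) / qpoch (b1 * l3) q (P + p))))) (UNIV \<times> (UNIV \<times> UNIV))"
      unfolding F_def G_def H_def R_def Q_def
      by (intro has_sum_mult_prod erdelyi_has_sum[OF q] q_beta_has_sum[OF q] x xs y ye n nz)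
    from has_sum_cmult_right[OF this, of "D P p"]
    show "((\<lambda>ijk. (\<lambda>((P, p), (i, j, k)). W ((i, j, k), (P, p))) (Pp, ijk)) has_sum
       (\<lambda>(P, p). D P p * ((qpoch s q P * qpoch (b1 / s) q p * phi21 q a1 (b1 * Q ^ (P + p)) (B1 *
         l1) x) *
       ((qpoch e q P * qpoch (a2 / e) q p * phi21 q b2 (a2 * Q ^ (P + p)) (B2 * l2) y) *
        (qpoch b1 q (P + p) / qpoch (b1 * l3) q (P + p))))) Pp) UNIV"
      by (simp add: Pp W_def case_prod_unfold mult_ac)
  qed
  \<comment> \<open>After cancellation the summand depends on P + p only, apart from (e)_P t^P (t)_p
    / ((q)_P (q)_p).\<close>
  then have "((\<lambda>(P, p). z ^ (P + p) / qpoch (b1 * l3) q (P + p) *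
     (qpoch b1 q (P + p) * phi21 q a1 (b1 * Q ^ (P + p)) (B1 * l1) x) *
     phi21 q b2 (a2 * Q ^ (P + p)) (B2 * l2) y * (qpoch e q P * t ^ P * qpoch t q p / (R P *
       R p))) has_sum S) UNIV"
    using s0 bs0 by (simp add: D_def par(7)[symmetric]
      power_mult_distrib power_add mult_ac case_prod_unfold)
  then have "((\<lambda>(N, P). z ^ N / qpoch (b1 * l3) q N *
     (qpoch b1 q N * phi21 q a1 (b1 * Q ^ N) (B1 * l1) x) *
     phi21 q b2 (a2 * Q ^ N) (B2 * l2) y * (qpoch e q P * t ^ P * qpoch t q (N - P) / (R P *
       R (N - P)))) has_sum S)
       (Sigma UNIV (\<lambda>N. {..N}))"
    by (rule iffD1[OF has_sum_reindex_bij_witness[of UNIV "\<lambda>(N, P). (P, N - P)"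
      "\<lambda>(P, p). (P + p, P)"], rotated -1]) auto
  then have "((\<lambda>N. \<Sum>P\<le>N. z ^ N / qpoch (b1 * l3) q N *
     (qpoch b1 q N * phi21 q a1 (b1 * Q ^ N) (B1 * l1) x) *
     phi21 q b2 (a2 * Q ^ N) (B2 * l2) y * (qpoch e q P * t ^ P * qpoch t q (N - P) / (R P *
       R (N - P)))) has_sum S) UNIV"
    by (rule has_sum_SigmaD) auto
  also have "(\<lambda>N. \<Sum>P\<le>N. z ^ N / qpoch (b1 * l3) q N *
     (qpoch b1 q N * phi21 q a1 (b1 * Q ^ N) (B1 * l1) x) *
     phi21 q b2 (a2 * Q ^ N) (B2 * l2) y * (qpoch e q P * t ^ P * qpoch t q (N - P) / (R P *
       R (N - P)))) = T"
  proof
    fix N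
    have "(\<Sum>P\<le>N. qpoch e q P * t ^ P * qpoch t q (N - P) / (R P * R (N - P))) = qpoch (e * t)
      q N / R N"
      unfolding R_def Q_def by (rule qpoch_convolution[OF qpoch_q_nonzero[OF q]])
    also have "e * t = a2"
      using nz by (simp add: par)
    finally have "(\<Sum>P\<le>N. qpoch e q P * t ^ P * qpoch t q (N - P) / (R P * R (N - P))) =
      qpoch a2 q N / R N" .
    then show "(\<Sum>P\<le>N. z ^ N / qpoch (b1 * l3) q N *
     (qpoch b1 q N * phi21 q a1 (b1 * Q ^ N) (B1 * l1) x) *
     phi21 q b2 (a2 * Q ^ N) (B2 * l2) y * (qpoch e q P * t ^ P * qpoch t q (N - P) / (R P *
       R (N - P)))) = T N"
      unfolding sum_distrib_left[symmetric] by (simp add: T_def mult_ac)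
  qed
  finally have TS: "(T has_sum S) UNIV" .

  have shift: "(\<Sum>\<^sub>\<infinity>m. qpoch a q m * qpoch b q (m + N) / (qpoch c q m * qpoch (of_real q) q m) *
    w ^ m) =
      qpoch b q N * phi21 q a (b * Q ^ N) c w" for a b c w N
    unfolding phi21_def infsum_cmult_right'[symmetric]
    by (rule infsum_cong) (subst add.commute, simp add: qpoch_add Q_def mult_ac)
  have "(T has_sum PhiK \<alpha>\<^sub>1 \<alpha>\<^sub>2 \<beta>\<^sub>1 \<beta>\<^sub>2 (\<alpha>\<^sub>1 + \<eta>\<^sub>1) (\<beta>\<^sub>2 + \<mu>\<^sub>2) \<gamma>\<^sub>3 q x y z) UNIV"
    using PhiK_has_sum[OF q x(1) y(1) z, of \<gamma>\<^sub>3 \<alpha>\<^sub>1 \<beta>\<^sub>1 "\<alpha>\<^sub>1 + \<eta>\<^sub>1" \<beta>\<^sub>2 \<alpha>\<^sub>2 "\<beta>\<^sub>2 + \<mu>\<^sub>2"]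
    unfolding shift par a1_def[symmetric] a2_def[symmetric] b1_def[symmetric] b2_def[symmetric]
    by (simp add: T_def[abs_def] R_def Q_def)
  then have lhs: "PhiK \<alpha>\<^sub>1 \<alpha>\<^sub>2 \<beta>\<^sub>1 \<beta>\<^sub>2 (\<alpha>\<^sub>1 + \<eta>\<^sub>1) (\<beta>\<^sub>2 + \<mu>\<^sub>2) \<gamma>\<^sub>3 q x y z = S"
    using TS has_sum_unique by blast

  \<comment> \<open>Summation over the series indices first\<close>
  define w1 where "w1 i = qpoch_inf B1 q / qpoch_inf (B1 * l1) q * B1 ^ i * qpoch l1 q i /
    R i" for i
  define w2 where "w2 j = qpoch_inf B2 q / qpoch_inf (B2 * l2) q * B2 ^ j * qpoch l2 q j /
    R j" for j
  define A where "A i j = phi3_coeff e s (a1 / B1) (inverse (Q ^ i)) (b2 / B2) (inverse (Q ^ j))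
            l1 (Q / (Q ^ i * x)) l2 (Q / (Q ^ j * y)) (Q ^ i * x * s) (Q ^ j * y * e)
              s q Q Q" for i j
  define Phi where "Phi i j k = (\<lambda>x' y'. PhiK \<alpha>\<^sub>1 (\<alpha>\<^sub>2 - \<eta>\<^sub>2) (\<beta>\<^sub>1 - lam\<^sub>3) \<beta>\<^sub>2
            (\<alpha>\<^sub>1 - lam\<^sub>1 + \<eta>\<^sub>1) (\<beta>\<^sub>2 - lam\<^sub>2 + \<mu>\<^sub>2) (\<beta>\<^sub>1 - lam\<^sub>3) q
            (Q ^ i * x' * s) (Q ^ j * y' * e) (Q ^ k * z))" for i j k
  define pre where "pre i j = qpoch_inf (Q ^ i * x * s) q * qpoch_inf (Q ^ j * y * e) q /
         (qpoch_inf (Q ^ i * x) q * qpoch_inf (Q ^ j * y) q)" for i j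
  define I where "I = (\<lambda>(i, j, k). w1 i * w2 j * H k * pre i j * qshift_series q (A i j) (Q ^ k *
    z * t) (Phi i j k) x y)"
  have "(I has_sum S) UNIV"
  proof (rule has_sum_prodD[OF WS])
    fix ijk :: "nat \<times> nat \<times> nat"
    obtain i j k where ijk: "ijk = (i, j, k)" by (metis prod_cases3)
    \<comment> \<open>The index p is summed before P because the inner function is evaluated at
      arguments shifted by q^P.\<close>
    have inner: "((\<lambda>p. W ((i, j, k), (P, p))) has_sum
        w1 i * w2 j * H k * pre i j * (A i j P * (Q ^ k * z * t) ^ P * Phi i j k (Q ^ P * x)
          (Q ^ P * y))) UNIV" for P
    proof -
      define E1 where "E1 = (\<Sum>\<^sub>\<infinity>m. qpoch s q (P + m) * (qpoch (a1 / B1) q m *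
        qpoch (inverse (Q ^ i)) q m / (qpoch l1 q m * qpoch (Q / (Q ^ i * x)) q m)) *
        (Q ^ m / qpoch Q q m))"
      define E2 where "E2 = (\<Sum>\<^sub>\<infinity>m. qpoch e q (P + m) * (qpoch (b2 / B2) q m *
        qpoch (inverse (Q ^ j)) q m / (qpoch l2 q m * qpoch (Q / (Q ^ j * y)) q m)) *
        (Q ^ m / qpoch Q q m))"
      define U where "U p = (\<Sum>\<^sub>\<infinity>m. qpoch a1 q m * qpoch (b1 / s) q (m + p) / (qpoch B1 q m *
        qpoch Q q m) * (Q ^ i * x * s * Q ^ P) ^ m)" for p
      define V where "V p = (\<Sum>\<^sub>\<infinity>m. qpoch b2 q m * qpoch (a2 / e) q (m + p) / (qpoch B2 q m *
        qpoch Q q m) * (Q ^ j * y * e * Q ^ P) ^ m)" for p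
      have F: "F P p i = w1 i * (qpoch_inf (Q ^ i * x * s) q / qpoch_inf (Q ^ i * x) q) /
        qpoch (Q ^ i * x * s) q P * E1 * U p" for p
        unfolding F_def erdelyi_term_def w1_def E1_def U_def R_def Q_def ..
      have G: "G P p j = w2 j * (qpoch_inf (Q ^ j * y * e) q / qpoch_inf (Q ^ j * y) q) /
        qpoch (Q ^ j * y * e) q P * E2 * V p" for p
        unfolding G_def erdelyi_term_def w2_def E2_def V_def R_def Q_def ..
      have A: "A i j P = 1 / (qpoch (Q ^ i * x * s) q P * qpoch (Q ^ j * y * e) q P *
        qpoch s q P * R P) * (E1 * E2)"
        unfolding A_def E1_def E2_def R_def Q_def by (rule phi3_coeff_factor[OF q])
      have nx: "norm (Q ^ i * x * s * Q ^ P) < 1"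
        using norm_mult_q_power_less[OF q xs, of "i + P"] by (simp add: Q_def power_add mult_ac)
      have ny: "norm (Q ^ j * y * e * Q ^ P) < 1"
        using norm_mult_q_power_less[OF q ye, of "j + P"] by (simp add: Q_def power_add mult_ac)
      have nz: "norm (Q ^ k * z) < 1"
        using norm_mult_q_power_less[OF q z, of k] by (simp add: Q_def mult_ac)
      have Phi: "Phi i j k (Q ^ P * x) (Q ^ P * y) = PhiK \<alpha>\<^sub>1 (\<alpha>\<^sub>2 - \<eta>\<^sub>2) (\<beta>\<^sub>1 - lam\<^sub>3) \<beta>\<^sub>2
            (\<alpha>\<^sub>1 - lam\<^sub>1 + \<eta>\<^sub>1) (\<beta>\<^sub>2 - lam\<^sub>2 + \<mu>\<^sub>2) (\<beta>\<^sub>1 - lam\<^sub>3) q (Q ^ i * x * s * Q ^ P)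
              (Q ^ j * y * e * Q ^ P) (Q ^ k * z)"
        by (simp add: Phi_def mult_ac)
      have "((\<lambda>p. (Q ^ k * z) ^ p / (qpoch (b1 / s) q p * R p) * U p * V p) has_sum
        Phi i j k (Q ^ P * x) (Q ^ P * y)) UNIV"
        unfolding Phi
        using PhiK_has_sum[OF q nx ny nz, of "\<beta>\<^sub>1 - lam\<^sub>3" \<alpha>\<^sub>1 "\<beta>\<^sub>1 - lam\<^sub>3"
          "\<alpha>\<^sub>1 - lam\<^sub>1 + \<eta>\<^sub>1" \<beta>\<^sub>2 "\<alpha>\<^sub>2 - \<eta>\<^sub>2" "\<beta>\<^sub>2 - lam\<^sub>2 + \<mu>\<^sub>2"]
        unfolding U_def V_def R_def a1_def[symmetric] b2_def[symmetric] B1_def[symmetric]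
          B2_def[symmetric]
          t_def[symmetric] par(6,7) Q_def .
      from has_sum_cmult_right[OF this, of "w1 i * w2 j * H k * pre i j * (A i j P * (Q ^ k * z *
        t) ^ P)"]
      have "((\<lambda>p. w1 i * w2 j * H k * pre i j * (A i j P * (Q ^ k * z * t) ^ P) *
          ((Q ^ k * z) ^ p / (qpoch (b1 / s) q p * R p) * U p * V p)) has_sum
          w1 i * w2 j * H k * pre i j * (A i j P * (Q ^ k * z * t) ^ P * Phi i j k (Q ^ P * x)
            (Q ^ P * y))) UNIV"
        by (simp only: mult.assoc)
      also have "(\<lambda>p. w1 i * w2 j * H k * pre i j * (A i j P * (Q ^ k * z * t) ^ P) *
          ((Q ^ k * z) ^ p / (qpoch (b1 / s) q p * R p) * U p * V p)) = (\<lambda>p. W ((i, j, k), (P, p)))"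
        by (rule ext)
           (simp add: W_def F G A pre_def D_def divide_inverse power_mult_distrib power_add
              add_mult_distrib2 power_mult mult_ac)
      finally show ?thesis .
    qed
    \<comment> \<open>With summability in (P, p) at a fixed node, the series in
      \<open>qshift_series\<close> has a genuine sum rather than the default value 0.\<close>
    have "(\<lambda>Pp. W (ijk, Pp)) summable_on UNIV"
      using summable_on_SigmaD1[where f = "\<lambda>u v. W (u, v)" and A = UNIV and B = "\<lambda>_. UNIV" and x =
        ijk] \<open>W summable_on UNIV\<close>
      by (simp add: case_prod_unfold)
    then have "((\<lambda>Pp. W (ijk, Pp)) has_sum (\<Sum>\<^sub>\<infinity>Pp. W (ijk, Pp))) UNIV"
      by simp
    moreover from this have "((\<lambda>P. w1 i * w2 j * H k * pre i j * (A i j P * (Q ^ k * z * t) ^ P *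
      Phi i j k (Q ^ P * x) (Q ^ P * y)))
        has_sum (\<Sum>\<^sub>\<infinity>Pp. W (ijk, Pp))) UNIV"
      by (rule has_sum_prodD) (unfold ijk, rule inner)
    from infsumI[OF this] have "(\<Sum>\<^sub>\<infinity>Pp. W (ijk, Pp)) = I ijk"
      by (simp add: ijk I_def qshift_series_def qshift_funpow infsum_cmult_right' Q_def[symmetric])
    ultimately show "((\<lambda>Pp. W (ijk, Pp)) has_sum I ijk) UNIV"
      by simp
  qed
  then have "infsum I UNIV = S"
    by (rule infsumI)
  have d1: "of_real ((1 - q) * q ^ i) * qdirichlet q (\<alpha>\<^sub>1 - lam\<^sub>1 + \<eta>\<^sub>1) lam\<^sub>1 (q ^ i) = w1 i" for i
    using qdirichlet_power[OF q, of "\<alpha>\<^sub>1 - lam\<^sub>1 + \<eta>\<^sub>1" lam\<^sub>1 i] assms(3,4)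
    by (simp add: w1_def B1_def l1_def R_def Q_def)
  have d2: "of_real ((1 - q) * q ^ i) * qdirichlet q (\<beta>\<^sub>2 - lam\<^sub>2 + \<mu>\<^sub>2) lam\<^sub>2 (q ^ i) = w2 i" for i
    using qdirichlet_power[OF q, of "\<beta>\<^sub>2 - lam\<^sub>2 + \<mu>\<^sub>2" lam\<^sub>2 i] assms(5,6)
    by (simp add: w2_def B2_def l2_def R_def Q_def)
  have d3: "of_real ((1 - q) * q ^ i) * qdirichlet q \<beta>\<^sub>1 (\<gamma>\<^sub>3 - \<beta>\<^sub>1) (q ^ i) = H i" for i
    using qdirichlet_power[OF q, of \<beta>\<^sub>1 "\<gamma>\<^sub>3 - \<beta>\<^sub>1" i] assms(7,8)
    by (simp add: H_def b1_def l3_def R_def Q_def)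
  show ?thesis
    unfolding lhs \<open>infsum I UNIV = S\<close>[symmetric] qintegral3_def infsum_cmult_right'[symmetric]
  proof (rule infsum_cong, clarify)
    fix i j k :: nat
    show "I (i, j, k) = of_real ((1 - q) ^ 3) * (
       qpoch_inf (of_real (q ^ i) * x * qpow q lam\<^sub>3) q * qpoch_inf (of_real (q ^ j) * y *
         qpow q \<eta>\<^sub>2) q /
         (qpoch_inf (of_real (q ^ i) * x) q * qpoch_inf (of_real (q ^ j) * y) q) *
       qshift_series q
         (phi3_coeff
            (qpow q \<eta>\<^sub>2) (qpow q lam\<^sub>3)
            (qpow q (lam\<^sub>1 - \<eta>\<^sub>1)) (inverse (of_real (q ^ i)))
            (qpow q (lam\<^sub>2 - \<mu>\<^sub>2)) (inverse (of_real (q ^ j)))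
            (qpow q lam\<^sub>1) (of_real q / (of_real (q ^ i) * x))
            (qpow q lam\<^sub>2) (of_real q / (of_real (q ^ j) * y))
            (of_real (q ^ i) * x * qpow q lam\<^sub>3) (of_real (q ^ j) * y * qpow q \<eta>\<^sub>2) (qpow q lam\<^sub>3)
            q (of_real q) (of_real q))
         (of_real (q ^ k) * z * qpow q (\<alpha>\<^sub>2 - \<eta>\<^sub>2))
         (\<lambda>x' y'. PhiK \<alpha>\<^sub>1 (\<alpha>\<^sub>2 - \<eta>\<^sub>2) (\<beta>\<^sub>1 - lam\<^sub>3) \<beta>\<^sub>2
            (\<alpha>\<^sub>1 - lam\<^sub>1 + \<eta>\<^sub>1) (\<beta>\<^sub>2 - lam\<^sub>2 + \<mu>\<^sub>2) (\<beta>\<^sub>1 - lam\<^sub>3) q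
            (of_real (q ^ i) * x' * qpow q lam\<^sub>3) (of_real (q ^ j) * y' * qpow q \<eta>\<^sub>2)
              (of_real (q ^ k) * z))
         x y *
       qdirichlet q (\<alpha>\<^sub>1 - lam\<^sub>1 + \<eta>\<^sub>1) lam\<^sub>1 (q ^ i) *
       qdirichlet q (\<beta>\<^sub>2 - lam\<^sub>2 + \<mu>\<^sub>2) lam\<^sub>2 (q ^ j) *
       qdirichlet q \<beta>\<^sub>1 (\<gamma>\<^sub>3 - \<beta>\<^sub>1) (q ^ k) * of_real (q ^ (i + j + k)))"
      unfolding I_def prod.case d1[symmetric] d2[symmetric] d3[symmetric] pre_def A_def Phi_def
        par(1,2)[symmetric] e_def s_def l1_def l2_def t_def Q_def of_real_power
      by (simp add: power_add power3_eq_cube)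
  qed
qed

end
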